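(* There exists a universal constant $C>0$ such that for every $n$, if $\nu_n$ denotes the probability measure distributed uniformly on the discrete cube $\{-1,1\}^n\subset\mathbb{R}^n$, then $$\mathrm{Var}(F_{\nu_n})\ \le\ \frac{C}{n^3}.$$
   Context: $x\cdot y$ denotes the Euclidean inner product on $\mathbb{R}^n$. $S^{n-1}$ is the Euclidean unit sphere and $\sigma_{n-1}$ the uniform (rotation-invariant) probability measure on it. For a Borel probability measure $\mu$ on $\mathbb{R}^n$ with finite first moment, $F_\mu:S^{n-1}\to\mathbb{R}$ is $F_\mu(\theta)=\int_{\mathbb{R}^n}(x\cdot\theta)_+\,d\mu(x)$, where $t_+=\max\{t,0\}$. $\mathrm{Var}(F_\mu)$ is the variance of $F_\mu$ with respect to $\sigma_{n-1}$. The measure $\nu_n$ assigns mass $2^{-n}$ to each vertex of $\{-1,1\}^n$. *)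

theory Defs
  imports "HOL-Probability.Probability"
begin

text \<open>
  Since the dimension is bound inside the scope of the universal constant, \<open>\<real>\<^sup>n\<close> is
  represented by the functions \<open>{..<n} \<rightarrow>\<^sub>E UNIV\<close>, i.e. by the space of the product
  \<open>\<sigma>\<close>-algebra below, which is the Borel \<open>\<sigma>\<close>-algebra of \<open>\<real>\<^sup>n\<close>.
\<close>

definition borel_vec :: "nat \<Rightarrow> (nat \<Rightarrow> real) measure" where
  "borel_vec n = PiM {..<n} (\<lambda>_. borel)"

definition dot :: "nat \<Rightarrow> (nat \<Rightarrow> real) \<Rightarrow> (nat \<Rightarrow> real) \<Rightarrow> real" where
  "dot n x y = (\<Sum>i<n. x i * y i)"

definition unit_sphere :: "nat \<Rightarrow> (nat \<Rightarrow> real) set" where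
  "unit_sphere n = {x \<in> {..<n} \<rightarrow>\<^sub>E UNIV. L2_set x {..<n} = 1}"

definition orthogonal_mat :: "nat \<Rightarrow> (nat \<Rightarrow> nat \<Rightarrow> real) \<Rightarrow> bool" where
  "orthogonal_mat n Q \<longleftrightarrow>
     (\<forall>i<n. \<forall>j<n. (\<Sum>k<n. Q k i * Q k j) = (if i = j then 1 else 0)) \<and>
     (\<forall>i<n. \<forall>j<n. (\<Sum>k<n. Q i k * Q j k) = (if i = j then 1 else 0))"

definition mat_app :: "nat \<Rightarrow> (nat \<Rightarrow> nat \<Rightarrow> real) \<Rightarrow> (nat \<Rightarrow> real) \<Rightarrow> (nat \<Rightarrow> real)" where
  "mat_app n Q x = (\<lambda>i\<in>{..<n}. \<Sum>j<n. Q i j * x j)"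

text \<open>
  Invariance is required under the full orthogonal group: for \<open>n = 1\<close> the special orthogonal
  group is trivial and would not force the two points of \<open>S\<^sup>0\<close> to have equal mass.
\<close>

definition uniform_sphere_measure :: "nat \<Rightarrow> (nat \<Rightarrow> real) measure \<Rightarrow> bool" where
  "uniform_sphere_measure n \<sigma> \<longleftrightarrow>
     prob_space \<sigma> \<and>
     space \<sigma> = unit_sphere n \<and>
     sets \<sigma> = sets (restrict_space (borel_vec n) (unit_sphere n)) \<and>
     (\<forall>Q. orthogonal_mat n Q \<longrightarrow> distr \<sigma> \<sigma> (mat_app n Q) = \<sigma>)"

definition F_fun :: "nat \<Rightarrow> (nat \<Rightarrow> real) measure \<Rightarrow> (nat \<Rightarrow> real) \<Rightarrow> real" where
  "F_fun n \<mu> \<theta> = (\<integral>x. max (dot n x \<theta>) 0 \<partial>\<mu>)"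

definition cube :: "nat \<Rightarrow> (nat \<Rightarrow> real) set" where
  "cube n = {..<n} \<rightarrow>\<^sub>E {-1, 1}"

definition cube_measure :: "nat \<Rightarrow> (nat \<Rightarrow> real) measure" where
  "cube_measure n = distr (uniform_count_measure (cube n)) (borel_vec n) (\<lambda>x. x)"

lemma emeasure_cube_measure:
  assumes "x \<in> cube n"
  shows "emeasure (cube_measure n) {x} = ennreal (1 / 2 ^ n)"
proof -
  have fin: "finite (cube n)" unfolding cube_def by (intro finite_PiE) auto
  have "card {-1, 1 :: real} = 2" by simp
  then have card: "card (cube n) = 2 ^ n" unfolding cube_def by (subst card_PiE) (simp_all only: prod_constant, auto)
  have ne: "cube n \<noteq> {}" using assms by auto
  have "{x} = (\<Pi>\<^sub>E i\<in>{..<n}. {x i})"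
    using assms by (intro PiE_singleton[symmetric]) (simp add: cube_def PiE_iff)
  also have "\<dots> \<in> sets (borel_vec n)"
    unfolding borel_vec_def by (intro sets_PiM_I_finite) auto
  finally have sx: "{x} \<in> sets (borel_vec n)" .
  have sp: "cube n \<subseteq> space (borel_vec n)"
    by (auto simp: cube_def borel_vec_def space_PiM)
  have "(\<lambda>x. x) \<in> uniform_count_measure (cube n) \<rightarrow>\<^sub>M borel_vec n"
    using sp by (auto simp: measurable_def space_uniform_count_measure sets_uniform_count_measure)
  then have "emeasure (cube_measure n) {x} = emeasure (uniform_count_measure (cube n)) {x}"
    using assms sx by (simp add: cube_measure_def emeasure_distr space_uniform_count_measure vimage_def Int_absorb2)
  also have "\<dots> = ennreal (1 / 2 ^ n)"
    using assms by (simp add: emeasure_uniform_count_measure fin card)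
  finally show ?thesis .
qed

text \<open>
  The predicate \<^const>\<open>uniform_sphere_measure\<close> is satisfiable in every dimension \<open>n \<ge> 1\<close>:
  radial projection sends Lebesgue measure on the punctured unit ball to an invariant measure.
  Orthogonal invariance of Lebesgue measure is obtained from its invariance under translations
  and \<open>x \<mapsto> -x\<close> by Fubini's theorem, comparing an arbitrary set with the ball.
\<close>

definition leb :: "nat \<Rightarrow> (nat \<Rightarrow> real) measure" where
  "leb n = PiM {..<n} (\<lambda>_. lborel)"

interpretation lebP: product_sigma_finite "\<lambda>_::nat. lborel :: real measure" ..

lemma sets_leb: "sets (leb n) = sets (borel_vec n)"
  unfolding leb_def borel_vec_def by (rule sets_PiM_cong) auto

lemma space_leb: "space (leb n) = {..<n} \<rightarrow>\<^sub>E UNIV"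
  by (simp add: leb_def space_PiM)

lemma space_borel_vec: "space (borel_vec n) = {..<n} \<rightarrow>\<^sub>E UNIV"
  by (simp add: borel_vec_def space_PiM)

lemma sigma_finite_leb: "sigma_finite_measure (leb n)"
  unfolding leb_def by (rule lebP.sigma_finite) simp

lemma coord_meas: "i < n \<Longrightarrow> (\<lambda>x. x i) \<in> borel_measurable (borel_vec n)"
  unfolding borel_vec_def by (rule measurable_component_singleton) simp

lemma leb_affine:
  assumes s: "s = 1 \<or> s = (-1::real)"
  shows "distr (leb n) (borel_vec n) (\<lambda>x. \<lambda>i\<in>{..<n}. s * x i + a i) = leb n"
    (is "?D = _")
proof -
  let ?f = "\<lambda>x. \<lambda>i\<in>{..<n}. s * x i + a i"
  have m: "?f \<in> leb n \<rightarrow>\<^sub>M borel_vec n"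
    unfolding borel_vec_def leb_def
    by (rule measurable_restrict) simp
  have "?D = PiM {..<n} (\<lambda>_. lborel)"
  proof (rule lebP.PiM_eqI)
    show "sets ?D = sets (PiM {..<n} (\<lambda>_. lborel :: real measure))"
      using sets_leb by (simp add: leb_def)
    fix A :: "nat \<Rightarrow> real set" assume A: "\<And>i. i \<in> {..<n} \<Longrightarrow> A i \<in> sets lborel"
    have A': "Pi\<^sub>E {..<n} A \<in> sets (borel_vec n)"
      unfolding borel_vec_def using A by (intro sets_PiM_I_finite) auto
    have v: "?f -` (Pi\<^sub>E {..<n} A) \<inter> space (leb n) = (\<Pi>\<^sub>E i\<in>{..<n}. (\<lambda>x. a i + s * x) -` A i)"
      by (auto simp: space_leb PiE_iff extensional_def add.commute)
    have pre: "(\<lambda>x. a i + s * x) -` A i \<in> sets lborel" if "i < n" for i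
    proof -
      have "(\<lambda>x. a i + s * x) \<in> borel_measurable borel" by simp
      from measurable_sets[OF this, of "A i"] A[of i] that show ?thesis by simp
    qed
    have "emeasure lborel ((\<lambda>x. a i + s * x) -` A i) = emeasure lborel (A i)" if "i < n" for i
    proof -
      have "lborel = density (distr lborel borel (\<lambda>x. a i + s * x)) (\<lambda>_. ennreal \<bar>s\<bar>)"
        using lborel_real_affine[of s "a i"] s by auto
      also have "\<dots> = distr lborel borel (\<lambda>x. a i + s * x)"
        using s by (auto simp: density_1)
      finally have "emeasure lborel (A i) = emeasure (distr lborel borel (\<lambda>x. a i + s * x)) (A i)"
        by simp
      then show ?thesis using A[of i] that by (subst (asm) emeasure_distr) auto
    qed
    then show "emeasure ?D (Pi\<^sub>E {..<n} A) = (\<Prod>i\<in>{..<n}. emeasure lborel (A i))"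
      using pre lebP.emeasure_PiM[of "{..<n}" "\<lambda>i. (\<lambda>x. a i + s * x) -` A i"]
      by (subst emeasure_distr[OF m A'], unfold v) (simp add: leb_def)
  qed simp
  then show ?thesis by (simp add: leb_def)
qed

lemma mat_app_meas: "mat_app n Q \<in> borel_vec n \<rightarrow>\<^sub>M borel_vec n"
proof -
  have "(\<lambda>x. \<lambda>i\<in>{..<n}. \<Sum>j<n. Q i j * x j) \<in> borel_vec n \<rightarrow>\<^sub>M PiM {..<n} (\<lambda>_. borel)"
    by (rule measurable_restrict)
      (auto intro!: borel_measurable_sum borel_measurable_times coord_meas)
  then show ?thesis by (simp add: mat_app_def[abs_def] borel_vec_def)
qed

lemma mat_app_space: "mat_app n Q x \<in> {..<n} \<rightarrow>\<^sub>E UNIV"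
  by (auto simp: mat_app_def)

lemma mat_app_transpose:
  assumes "orthogonal_mat n Q" "y \<in> {..<n} \<rightarrow>\<^sub>E UNIV"
  shows "mat_app n Q (mat_app n (\<lambda>i j. Q j i) y) = y"
proof
  fix i show "mat_app n Q (mat_app n (\<lambda>i j. Q j i) y) i = y i"
  proof (cases "i < n")
    case True
    then have "mat_app n Q (mat_app n (\<lambda>i j. Q j i) y) i = (\<Sum>j<n. Q i j * (\<Sum>k<n. Q k j * y k))"
      by (simp add: mat_app_def)
    also have "\<dots> = (\<Sum>j<n. \<Sum>k<n. Q i j * Q k j * y k)"
      by (simp add: sum_distrib_left mult.assoc)
    also have "\<dots> = (\<Sum>k<n. \<Sum>j<n. Q i j * Q k j * y k)"
      by (rule sum.swap)
    also have "\<dots> = (\<Sum>k<n. (if i = k then 1 else 0) * y k)"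
      using assms(1) True by (intro sum.cong) (auto simp: orthogonal_mat_def simp flip: sum_distrib_right)
    also have "\<dots> = (\<Sum>k<n. if i = k then y k else 0)" by (intro sum.cong) auto
    also have "\<dots> = y i" using True by simp
    finally show ?thesis .
  qed (use assms(2) in \<open>auto simp: mat_app_def PiE_iff extensional_def\<close>)
qed

lemma mat_app_norm:
  assumes "orthogonal_mat n Q"
  shows "L2_set (mat_app n Q x) {..<n} = L2_set x {..<n}"
proof -
  have "(\<Sum>i<n. (mat_app n Q x i)\<^sup>2) = (\<Sum>i<n. (\<Sum>j<n. Q i j * x j) * (\<Sum>k<n. Q i k * x k))"
    by (simp add: mat_app_def power2_eq_square)
  also have "\<dots> = (\<Sum>i<n. \<Sum>j<n. \<Sum>k<n. Q i j * x j * (Q i k * x k))"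
    by (simp add: sum_product)
  also have "\<dots> = (\<Sum>j<n. \<Sum>i<n. \<Sum>k<n. Q i j * x j * (Q i k * x k))"
    by (rule sum.swap)
  also have "\<dots> = (\<Sum>j<n. \<Sum>k<n. \<Sum>i<n. Q i j * x j * (Q i k * x k))"
    by (intro sum.cong refl sum.swap)
  also have "\<dots> = (\<Sum>j<n. \<Sum>k<n. (\<Sum>i<n. Q i j * Q i k) * (x j * x k))"
    unfolding sum_distrib_right by (simp add: ac_simps)
  also have "\<dots> = (\<Sum>j<n. \<Sum>k<n. (if j = k then x j * x k else 0))"
    using assms by (intro sum.cong refl) (auto simp: orthogonal_mat_def)
  also have "\<dots> = (\<Sum>j<n. (x j)\<^sup>2)"
    by (simp add: power2_eq_square)
  finally show ?thesis by (simp add: L2_set_def)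
qed

definition pball :: "nat \<Rightarrow> (nat \<Rightarrow> real) set" where
  "pball n = {x \<in> {..<n} \<rightarrow>\<^sub>E UNIV. 0 < L2_set x {..<n} \<and> L2_set x {..<n} \<le> 1}"

lemma L2_meas: "(\<lambda>x. L2_set x {..<n}) \<in> borel_measurable (borel_vec n)"
  unfolding L2_set_def
  by (intro measurable_compose[OF _ borel_measurable_sqrt] borel_measurable_sum
      borel_measurable_power coord_meas) auto

lemma pball_sets: "pball n \<in> sets (borel_vec n)"
proof -
  note L2_meas[measurable]
  have "{x \<in> space (borel_vec n). 0 < L2_set x {..<n} \<and> L2_set x {..<n} \<le> 1} \<in> sets (borel_vec n)"
    by measurable
  then show ?thesis by (simp add: pball_def space_borel_vec)
qed

lemma emeasure_leb_box: "emeasure (leb n) (\<Pi>\<^sub>E i\<in>{..<n}. {a..b}) = ennreal (b - a) ^ n" if "a \<le> b"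
  unfolding leb_def using that by (subst lebP.emeasure_PiM) (auto simp: prod_constant)

lemma pball_measure:
  assumes "n \<ge> 1"
  shows "emeasure (leb n) (pball n) \<noteq> 0" "emeasure (leb n) (pball n) \<noteq> \<infinity>"
proof -
  let ?c = "1 / real n"
  have "(\<Pi>\<^sub>E i\<in>{..<n}. {?c / 2..?c}) \<subseteq> pball n"
  proof
    fix x assume x: "x \<in> (\<Pi>\<^sub>E i\<in>{..<n}. {?c / 2..?c})"
    then have b: "?c / 2 \<le> x i" "x i \<le> ?c" if "i < n" for i using that by (auto simp: PiE_iff)
    have c: "?c > 0" using assms by simp
    have p: "x i > 0" if "i < n" for i using less_le_trans[OF half_gt_zero[OF c] b(1)[OF that]] .
    have "L2_set x {..<n} \<le> (\<Sum>i<n. \<bar>x i\<bar>)" by (rule L2_set_le_sum_abs)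
    also have "\<dots> \<le> (\<Sum>i<n. ?c)" using b(2) p by (intro sum_mono) (simp add: abs_of_pos)
    also have "\<dots> = 1" using assms by simp
    finally have "L2_set x {..<n} \<le> 1" .
    moreover have "x 0 \<le> L2_set x {..<n}"
      using assms by (intro member_le_L2_set) auto
    ultimately show "x \<in> pball n" using p[of 0] assms x by (auto simp: pball_def PiE_iff)
  qed
  then have "emeasure (leb n) (\<Pi>\<^sub>E i\<in>{..<n}. {?c / 2..?c}) \<le> emeasure (leb n) (pball n)"
    by (rule emeasure_mono) (simp add: sets_leb pball_sets)
  moreover have "emeasure (leb n) (\<Pi>\<^sub>E i\<in>{..<n}. {?c / 2..?c}) > 0"
    using assms by (subst emeasure_leb_box) (auto simp: ennreal_power field_simps)
  ultimately show "emeasure (leb n) (pball n) \<noteq> 0" by auto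
  have "pball n \<subseteq> (\<Pi>\<^sub>E i\<in>{..<n}. {-1..1})"
  proof
    fix x assume x: "x \<in> pball n"
    have "\<bar>x i\<bar> \<le> 1" if "i < n" for i
    proof -
      have "\<bar>x i\<bar> \<le> L2_set (\<lambda>i. \<bar>x i\<bar>) {..<n}"
        using that by (intro member_le_L2_set) auto
      also have "\<dots> = L2_set x {..<n}" by (simp add: L2_set_def)
      finally show ?thesis using x by (simp add: pball_def)
    qed
    then show "x \<in> (\<Pi>\<^sub>E i\<in>{..<n}. {-1..1})" using x by (auto simp: pball_def PiE_iff abs_le_iff)
  qed
  then have "emeasure (leb n) (pball n) \<le> emeasure (leb n) (\<Pi>\<^sub>E i\<in>{..<n}. {-1..1})"
    by (rule emeasure_mono) (auto simp: leb_def intro!: sets_PiM_I_finite)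
  also have "\<dots> < \<infinity>" by (subst emeasure_leb_box) (auto simp: power_less_top_ennreal)
  finally show "emeasure (leb n) (pball n) \<noteq> \<infinity>" by simp
qed

lemma leb_invariant:
  assumes "n \<ge> 1" and Q: "orthogonal_mat n Q" and A: "A \<in> sets (borel_vec n)"
  shows "emeasure (leb n) (mat_app n Q -` A \<inter> space (leb n)) = emeasure (leb n) A"
proof -
  interpret sigma_finite_measure "leb n" by (rule sigma_finite_leb)
  interpret P: pair_sigma_finite "leb n" "leb n" ..
  let ?T = "mat_app n Q" and ?B = "pball n" and ?L = "leb n"
  let ?V = "{..<n} \<rightarrow>\<^sub>E UNIV :: (nat \<Rightarrow> real) set"
  define add where "add x y = (\<lambda>i\<in>{..<n}. x i + y i :: real)" for x y :: "nat \<Rightarrow> real"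
  define sub where "sub x y = (\<lambda>i\<in>{..<n}. x i - y i :: real)" for x y :: "nat \<Rightarrow> real"
  note A[measurable] pball_sets[measurable]
  have meq: "measurable ?L M = measurable (borel_vec n) M" for M :: "'b measure"
    by (rule measurable_cong_sets) (simp_all add: sets_leb)
  have meq': "measurable (?L \<Otimes>\<^sub>M ?L) M = measurable (borel_vec n \<Otimes>\<^sub>M borel_vec n) M" for M :: "'b measure"
    by (rule measurable_cong_sets) (simp_all add: sets_leb cong: sets_pair_measure_cong)
  have Tm[measurable]: "?T \<in> borel_vec n \<rightarrow>\<^sub>M borel_vec n" by (rule mat_app_meas)
  have am[measurable]: "(\<lambda>p. add (fst p) (snd p)) \<in> borel_vec n \<Otimes>\<^sub>M borel_vec n \<rightarrow>\<^sub>M borel_vec n"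
  proof -
    have "(\<lambda>p. \<lambda>i\<in>{..<n}. fst p i + snd p i :: real) \<in> borel_vec n \<Otimes>\<^sub>M borel_vec n \<rightarrow>\<^sub>M PiM {..<n} (\<lambda>_. borel)"
      by (rule measurable_restrict)
        (auto intro!: borel_measurable_add measurable_compose[OF measurable_fst coord_meas]
           measurable_compose[OF measurable_snd coord_meas])
    then show ?thesis by (simp add: add_def[abs_def] borel_vec_def)
  qed
  have sm[measurable]: "(\<lambda>p. sub (fst p) (snd p)) \<in> borel_vec n \<Otimes>\<^sub>M borel_vec n \<rightarrow>\<^sub>M borel_vec n"
  proof -
    have "(\<lambda>p. \<lambda>i\<in>{..<n}. fst p i - snd p i :: real) \<in> borel_vec n \<Otimes>\<^sub>M borel_vec n \<rightarrow>\<^sub>M PiM {..<n} (\<lambda>_. borel)"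
      by (rule measurable_restrict)
        (auto intro!: borel_measurable_diff measurable_compose[OF measurable_fst coord_meas]
           measurable_compose[OF measurable_snd coord_meas])
    then show ?thesis by (simp add: sub_def[abs_def] borel_vec_def)
  qed
  have shift: "(\<integral>\<^sup>+x. f (\<lambda>i\<in>{..<n}. s * x i + a i) \<partial>?L) = (\<integral>\<^sup>+x. f x \<partial>?L)"
    if f: "f \<in> borel_measurable (borel_vec n)" and s: "s = 1 \<or> s = (-1::real)" for f s a
  proof -
    have "(\<lambda>x. \<lambda>i\<in>{..<n}. s * x i + a i) \<in> ?L \<rightarrow>\<^sub>M borel_vec n"
      unfolding borel_vec_def leb_def by (rule measurable_restrict) simp
    then have "(\<integral>\<^sup>+x. f x \<partial>distr ?L (borel_vec n) (\<lambda>x. \<lambda>i\<in>{..<n}. s * x i + a i))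
      = (\<integral>\<^sup>+x. f (\<lambda>i\<in>{..<n}. s * x i + a i) \<partial>?L)"
      using f by (intro nn_integral_distr) simp_all
    then show ?thesis by (simp add: leb_affine[OF s])
  qed
  have intA: "(\<integral>\<^sup>+x. indicator E x \<partial>?L) = emeasure ?L E" if "E \<in> sets (borel_vec n)" for E
    using that by (intro nn_integral_indicator) (simp add: sets_leb)
  have intT: "(\<integral>\<^sup>+x. indicator E (?T x) \<partial>?L) = emeasure ?L (?T -` E \<inter> space ?L)"
    if [measurable]: "E \<in> sets (borel_vec n)" for E
  proof -
    have "(\<integral>\<^sup>+x. indicator E (?T x) \<partial>?L) = (\<integral>\<^sup>+x. indicator (?T -` E \<inter> space ?L) x \<partial>?L)"
      by (intro nn_integral_cong) (auto simp: indicator_def)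
    also have "\<dots> = emeasure ?L (?T -` E \<inter> space ?L)"
      by (intro nn_integral_indicator measurable_sets[of _ _ "borel_vec n"]) (simp_all add: meq that)
    finally show ?thesis .
  qed
  have a1: "add x = (\<lambda>y. \<lambda>i\<in>{..<n}. 1 * y i + x i)" for x
    by (auto simp: add_def fun_eq_iff restrict_def)
  have s1: "sub x = (\<lambda>y. \<lambda>i\<in>{..<n}. -1 * y i + x i)" for x
    by (auto simp: sub_def fun_eq_iff restrict_def)

  have "emeasure ?L (?T -` A \<inter> space ?L) * emeasure ?L ?B
      = (\<integral>\<^sup>+x. indicator A (?T x) * emeasure ?L ?B \<partial>?L)"
    by (subst nn_integral_multc) (auto simp: intT A meq)
  also have "\<dots> = (\<integral>\<^sup>+x. (\<integral>\<^sup>+y. indicator A (?T x) * indicator ?B (add (?T x) y) \<partial>?L) \<partial>?L)"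
  proof (intro nn_integral_cong)
    fix x
    have "(\<integral>\<^sup>+y. indicator ?B (add (?T x) y) \<partial>?L) = emeasure ?L ?B"
      unfolding a1 by (subst shift) (auto simp: intA pball_sets)
    moreover have "(\<lambda>y. indicator ?B (add (?T x) y) :: ennreal) \<in> borel_measurable ?L"
    proof -
      have "?T x \<in> space (borel_vec n)" by (simp add: space_borel_vec mat_app_space)
      from measurable_compose[OF measurable_Pair1'[OF this] am]
      have [measurable]: "(\<lambda>y. add (?T x) y) \<in> borel_vec n \<rightarrow>\<^sub>M borel_vec n" by simp
      show ?thesis unfolding meq by measurable
    qed
    ultimately show "indicator A (?T x) * emeasure ?L ?B
        = (\<integral>\<^sup>+y. indicator A (?T x) * indicator ?B (add (?T x) y) \<partial>?L)"
      by (simp add: nn_integral_cmult)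
  qed
  also have "\<dots> = (\<integral>\<^sup>+y. (\<integral>\<^sup>+x. indicator A (?T x) * indicator ?B (add (?T x) y) \<partial>?L) \<partial>?L)"
  proof (rule P.Fubini'[symmetric])
    have [measurable]: "(\<lambda>p. add (?T (fst p)) (snd p)) \<in> borel_vec n \<Otimes>\<^sub>M borel_vec n \<rightarrow>\<^sub>M borel_vec n"
    proof -
      have "(\<lambda>p. (?T (fst p), snd p)) \<in> borel_vec n \<Otimes>\<^sub>M borel_vec n \<rightarrow>\<^sub>M borel_vec n \<Otimes>\<^sub>M borel_vec n"
        by measurable
      from measurable_compose[OF this am] show ?thesis by simp
    qed
    have "(\<lambda>p. indicator A (?T (fst p)) * indicator ?B (add (?T (fst p)) (snd p)) :: ennreal)
      \<in> borel_measurable (borel_vec n \<Otimes>\<^sub>M borel_vec n)" by measurable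
    then show "(\<lambda>(x, y). indicator A (?T x) * indicator ?B (add (?T x) y) :: ennreal)
      \<in> borel_measurable (?L \<Otimes>\<^sub>M ?L)" by (simp add: meq' case_prod_beta)
  qed
  also have "\<dots> = (\<integral>\<^sup>+y. (\<integral>\<^sup>+x. indicator A (sub (?T x) y) * indicator ?B (?T x) \<partial>?L) \<partial>?L)"
  proof (rule nn_integral_cong)
    fix y assume "y \<in> space ?L"
    then have y: "y \<in> ?V" by (simp add: space_leb)
    let ?z = "mat_app n (\<lambda>i j. Q j i) y"
    let ?g = "\<lambda>x. indicator A (sub (?T x) y) * indicator ?B (?T x) :: ennreal"
    have Ts: "?T (\<lambda>i\<in>{..<n}. 1 * x i + ?z i) = add (?T x) y" for x
    proof -
      have "?T (\<lambda>i\<in>{..<n}. 1 * x i + ?z i) = add (?T x) (?T ?z)"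
        by (auto simp: mat_app_def add_def fun_eq_iff distrib_left sum.distrib restrict_def)
      then show ?thesis by (simp add: mat_app_transpose[OF Q y])
    qed
    have sa: "sub (add (?T x) y) y = ?T x" for x
      by (auto simp: mat_app_def add_def sub_def fun_eq_iff restrict_def)
    have [measurable]: "(\<lambda>x. sub (?T x) y) \<in> borel_vec n \<rightarrow>\<^sub>M borel_vec n"
    proof -
      have "(\<lambda>x. (?T x, y)) \<in> borel_vec n \<rightarrow>\<^sub>M borel_vec n \<Otimes>\<^sub>M borel_vec n"
        using y by (auto intro!: measurable_Pair simp: space_borel_vec)
      from measurable_compose[OF this sm] show ?thesis by simp
    qed
    have "?g \<in> borel_measurable (borel_vec n)" by measurable
    from shift[OF this, of 1 ?z] show "(\<integral>\<^sup>+x. indicator A (?T x) * indicator ?B (add (?T x) y) \<partial>?L)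
        = (\<integral>\<^sup>+x. ?g x \<partial>?L)" unfolding Ts sa by simp
  qed
  also have "\<dots> = (\<integral>\<^sup>+x. (\<integral>\<^sup>+y. indicator A (sub (?T x) y) * indicator ?B (?T x) \<partial>?L) \<partial>?L)"
  proof (rule P.Fubini')
    have [measurable]: "(\<lambda>p. sub (?T (fst p)) (snd p)) \<in> borel_vec n \<Otimes>\<^sub>M borel_vec n \<rightarrow>\<^sub>M borel_vec n"
    proof -
      have "(\<lambda>p. (?T (fst p), snd p)) \<in> borel_vec n \<Otimes>\<^sub>M borel_vec n \<rightarrow>\<^sub>M borel_vec n \<Otimes>\<^sub>M borel_vec n"
        by measurable
      from measurable_compose[OF this sm] show ?thesis by simp
    qed
    have "(\<lambda>p. indicator A (sub (?T (fst p)) (snd p)) * indicator ?B (?T (fst p)) :: ennreal)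
      \<in> borel_measurable (borel_vec n \<Otimes>\<^sub>M borel_vec n)" by measurable
    then show "(\<lambda>(x, y). indicator A (sub (?T x) y) * indicator ?B (?T x) :: ennreal)
      \<in> borel_measurable (?L \<Otimes>\<^sub>M ?L)" by (simp add: meq' case_prod_beta)
  qed
  also have "\<dots> = (\<integral>\<^sup>+x. emeasure ?L A * indicator ?B (?T x) \<partial>?L)"
  proof (intro nn_integral_cong)
    fix x
    have "(\<integral>\<^sup>+y. indicator A (sub (?T x) y) \<partial>?L) = emeasure ?L A"
      unfolding s1 by (subst shift) (auto simp: intA A)
    moreover have "(\<lambda>y. indicator A (sub (?T x) y) :: ennreal) \<in> borel_measurable ?L"
    proof -
      have "?T x \<in> space (borel_vec n)" by (simp add: space_borel_vec mat_app_space)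
      from measurable_compose[OF measurable_Pair1'[OF this] sm]
      have [measurable]: "(\<lambda>y. sub (?T x) y) \<in> borel_vec n \<rightarrow>\<^sub>M borel_vec n" by simp
      show ?thesis unfolding meq by measurable
    qed
    ultimately show "(\<integral>\<^sup>+y. indicator A (sub (?T x) y) * indicator ?B (?T x) \<partial>?L)
        = emeasure ?L A * indicator ?B (?T x)"
      by (simp add: nn_integral_multc)
  qed
  also have "\<dots> = emeasure ?L A * emeasure ?L (?T -` ?B \<inter> space ?L)"
    by (subst nn_integral_cmult) (auto simp: intT pball_sets meq)
  also have "?T -` ?B \<inter> space ?L = ?B"
    by (auto simp: pball_def space_leb mat_app_norm[OF Q] mat_app_space)
  finally show ?thesis
    using pball_measure[OF \<open>n \<ge> 1\<close>] by (simp add: mult.commute[of _ "emeasure (leb n) (pball n)"] ennreal_mult_cancel_left)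
qed

lemma uniform_sphere_measure_exists:
  assumes "n \<ge> 1"
  shows "\<exists>\<sigma>. uniform_sphere_measure n \<sigma>"
proof -
  let ?S = "restrict_space (borel_vec n) (unit_sphere n)"
  let ?M = "uniform_measure (leb n) (pball n)"
  define e :: "nat \<Rightarrow> real" where "e = (\<lambda>i\<in>{..<n}. if i = 0 then 1 else 0)"
  define u where "u x = (if L2_set x {..<n} = 0 then e else (\<lambda>i\<in>{..<n}. x i / L2_set x {..<n}))" for x
  have L2e: "L2_set e {..<n} = 1"
  proof -
    have "(\<Sum>i<n. (e i)\<^sup>2) = (\<Sum>i<n. if i = 0 then 1 else 0)"
      by (intro sum.cong) (auto simp: e_def)
    then show ?thesis using assms by (simp add: L2_set_def)
  qed
  have us: "u x \<in> unit_sphere n" for x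
  proof (cases "L2_set x {..<n} = 0")
    case True
    then show ?thesis using L2e by (auto simp: u_def unit_sphere_def e_def)
  next
    case False
    have "L2_set (\<lambda>i\<in>{..<n}. x i / L2_set x {..<n}) {..<n} = L2_set (\<lambda>i. inverse (L2_set x {..<n}) * x i) {..<n}"
      by (intro L2_set_cong) (auto simp: field_simps)
    also have "\<dots> = inverse (L2_set x {..<n}) * L2_set x {..<n}"
      by (simp add: L2_set_right_distrib)
    finally show ?thesis using False by (auto simp: u_def unit_sphere_def)
  qed
  have sph: "unit_sphere n \<in> sets (borel_vec n)"
  proof -
    note L2_meas[measurable]
    have "{x \<in> space (borel_vec n). L2_set x {..<n} = 1} \<in> sets (borel_vec n)" by measurable
    then show ?thesis by (simp add: unit_sphere_def space_borel_vec)
  qed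
  have um0: "u \<in> borel_vec n \<rightarrow>\<^sub>M borel_vec n"
  proof -
    note L2_meas[measurable]
    have [measurable]: "(\<lambda>x. \<lambda>i\<in>{..<n}. x i / L2_set x {..<n}) \<in> borel_vec n \<rightarrow>\<^sub>M borel_vec n"
      by (subst (2) borel_vec_def, rule measurable_restrict)
        (auto intro!: borel_measurable_divide coord_meas L2_meas)
    have "e \<in> space (borel_vec n)" by (auto simp: e_def space_borel_vec)
    then have [measurable]: "(\<lambda>_. e) \<in> borel_vec n \<rightarrow>\<^sub>M borel_vec n" by simp
    show ?thesis unfolding u_def[abs_def] by measurable
  qed
  have um: "u \<in> borel_vec n \<rightarrow>\<^sub>M ?S"
    using um0 us by (intro measurable_restrict_space2) auto
  have seq: "sets ?M = sets (borel_vec n)" by (simp add: sets_leb)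
  have umM: "u \<in> ?M \<rightarrow>\<^sub>M ?S" using um by (simp add: measurable_cong_sets[OF seq refl])
  let ?\<sigma> = "distr ?M ?S u"
  have pM: "prob_space ?M"
    using pball_measure[OF assms] by (rule prob_space_uniform_measure)
  have "distr ?\<sigma> ?\<sigma> (mat_app n Q) = ?\<sigma>" if Q: "orthogonal_mat n Q" for Q
  proof -
    let ?T = "mat_app n Q"
    have TS: "?T \<in> ?S \<rightarrow>\<^sub>M ?S"
      using mat_app_meas[of n Q] mat_app_norm[OF Q] mat_app_space[of n Q]
      by (intro measurable_restrict_space2 measurable_restrict_space1)
        (auto simp: unit_sphere_def space_restrict_space)
    have comm: "u (?T x) = ?T (u x)" if "L2_set x {..<n} \<noteq> 0" for x
      using that by (auto simp: u_def mat_app_norm[OF Q])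
        (auto simp: mat_app_def fun_eq_iff sum_divide_distrib restrict_def)
    show ?thesis
    proof (rule measure_eqI)
      fix X assume "X \<in> sets (distr ?\<sigma> ?\<sigma> ?T)"
      then have X: "X \<in> sets ?S" by simp
      let ?E = "u -` X \<inter> space (borel_vec n) \<inter> pball n"
      have E: "?E \<in> sets (borel_vec n)" using measurable_sets[OF um X] pball_sets by auto
      have TX: "?T -` X \<inter> space ?S \<in> sets ?S" using measurable_sets[OF TS X] .
      have em: "emeasure ?\<sigma> Y = emeasure (leb n) (u -` Y \<inter> space (borel_vec n) \<inter> pball n) / emeasure (leb n) (pball n)"
        if Y: "Y \<in> sets ?S" for Y
      proof -
        have "emeasure ?\<sigma> Y = emeasure ?M (u -` Y \<inter> space ?M)"
          by (rule emeasure_distr[OF umM Y])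
        also have "space ?M = space (borel_vec n)" by (rule sets_eq_imp_space_eq[OF seq])
        also have "emeasure ?M (u -` Y \<inter> space (borel_vec n))
          = emeasure (leb n) (pball n \<inter> (u -` Y \<inter> space (borel_vec n))) / emeasure (leb n) (pball n)"
          using measurable_sets[OF um Y] pball_sets
          by (intro emeasure_uniform_measure) (auto simp: sets_leb)
        finally show ?thesis by (simp add: Int_ac)
      qed
      have "emeasure (distr ?\<sigma> ?\<sigma> ?T) X = emeasure ?\<sigma> (?T -` X \<inter> space ?S)"
        using TS X by (subst emeasure_distr) auto
      also have "\<dots> = emeasure (leb n) (u -` (?T -` X \<inter> space ?S) \<inter> space (borel_vec n) \<inter> pball n) / emeasure (leb n) (pball n)"
        by (rule em[OF TX])
      also have "u -` (?T -` X \<inter> space ?S) \<inter> space (borel_vec n) \<inter> pball n = ?T -` ?E \<inter> space (leb n)"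
        using us mat_app_space[of n Q]
        by (auto simp: pball_def space_leb space_borel_vec space_restrict_space mat_app_norm[OF Q] comm unit_sphere_def)
      also have "emeasure (leb n) \<dots> = emeasure (leb n) ?E"
        by (rule leb_invariant[OF assms Q E])
      finally show "emeasure (distr ?\<sigma> ?\<sigma> ?T) X = emeasure ?\<sigma> X" by (simp add: em[OF X])
    qed simp
  qed
  moreover have "prob_space ?\<sigma>" by (rule prob_space.prob_space_distr[OF pM umM])
  moreover have "space ?\<sigma> = unit_sphere n"
    by (auto simp: space_restrict_space unit_sphere_def space_borel_vec)
  ultimately show ?thesis unfolding uniform_sphere_measure_def by (intro exI[of _ ?\<sigma>]) simp
qed

end

theory Submission
  imports Defs
begin

text \<open>
  Write \<open>x \<bullet> \<theta>\<close> for the inner product. The function \<open>F\<close> is half the mean of \<open>\<bar>x \<bullet> \<theta>\<bar>\<close> over the vertices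
  \<open>x\<close> of the cube, so its variance can be compared term by term:
  four times the second moment is the average over pairs of vertices of the integrals of \<open>\<bar>x \<bullet> \<theta>\<bar> \<bar>y \<bullet> \<theta>\<bar>\<close>, and
  four times the squared mean is \<open>n m\<^sup>2\<close>, where \<open>m\<close> is the mean of \<open>\<bar>\<theta> 0\<bar>\<close>. Both quantities have the expansion
  \<open>(2 / \<pi>) (1 + 1 / (2 n) + 1 / (8 n\<^sup>2))\<close> up to an error of order \<open>1 / n\<^sup>3\<close>, which is the theorem.

  Second moment. Averaging over the reflections in the plane of \<open>x\<close> and \<open>y\<close> shows that the
  integral of \<open>\<bar>x \<bullet> \<theta>\<bar> \<bar>y \<bullet> \<theta>\<bar>\<close> is \<open>(2 / \<pi>) h \<rho>\<close> with \<open>h \<rho> = sqrt (1 - \<rho>\<^sup>2) + \<rho> arcsin \<rho>\<close> and \<open>\<rho> = x \<bullet> y / n\<close>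
  (\<open>integral_abs_dot_product\<close>). As \<open>h \<rho> = 1 + \<rho>\<^sup>2 / 2 + \<rho>\<^sup>4 / 24\<close> up to an error of order \<open>\<rho>\<^sup>6\<close>, it only remains to insert the
  moments of the simple random walk \<open>x \<bullet> y\<close> (\<open>cube_moments\<close>).

  Mean. Integrating \<open>\<bar>G \<bullet> \<theta>\<bar>\<close> over \<open>\<theta>\<close> and over a standard Gaussian vector \<open>G\<close> gives, by Fubini,
  \<open>m E\<bar>G\<bar> = sqrt (2 / \<pi>)\<close> (\<open>mean_abs_times_gauss_norm\<close>). A lower bound for \<open>m\<close> is thus an upper bound
  for \<open>E\<bar>G\<bar>\<close>, and the latter follows from a polynomial majorant of the square root (\<open>sqrt_le_taylor5\<close>)
  and the explicit moments of \<open>\<bar>G\<bar>\<^sup>2\<close> (\<open>gauss_norm_moment\<close>).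

  The invariance of the measure on the sphere enters through Householder reflections: they exchange
  vectors of equal length, and in a plane they average as well as rotations do.
\<close>

section \<open>Inner products and Householder reflections\<close>

lemma dot_meas [measurable]: "dot n x \<in> borel_measurable (borel_vec n)"
  unfolding dot_def[abs_def]
  by (intro borel_measurable_sum borel_measurable_times coord_meas) auto

lemma dot_commute: "dot n x y = dot n y x"
  by (simp add: dot_def mult.commute)

lemma dot_nonneg: "0 \<le> dot n x x"
  by (auto simp: dot_def intro!: sum_nonneg)

lemma dot_add: "dot n (\<lambda>i. x i + y i) z = dot n x z + dot n y z"
  by (simp add: dot_def distrib_right sum.distrib)

lemma dot_diff: "dot n (\<lambda>i. x i - y i) z = dot n x z - dot n y z"
  by (simp add: dot_def left_diff_distrib sum_subtractf)

lemma dot_scale: "dot n (\<lambda>i. c * x i) z = c * dot n x z"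
  by (simp add: dot_def sum_distrib_left mult.assoc)

lemma dot_scale_right: "dot n z (\<lambda>i. c * x i) = c * dot n z x"
  by (simp add: dot_def sum_distrib_left mult_ac)

lemma dot_cong: "(\<And>i. i < n \<Longrightarrow> x i = x' i) \<Longrightarrow> dot n x y = dot n x' y"
  by (simp add: dot_def)

text \<open>
  The Householder matrix \<open>I - 2 w w\<^sup>T\<close> of the reflection in the hyperplane orthogonal to a unit vector \<open>w\<close>.
\<close>

definition reflection :: "(nat \<Rightarrow> real) \<Rightarrow> nat \<Rightarrow> nat \<Rightarrow> real" where
  "reflection w i j = (if i = j then 1 else 0) - 2 * w i * w j"

lemma orthogonal_reflection:
  assumes "dot n w w = 1"
  shows "orthogonal_mat n (reflection w)"
proof -
  have "(\<Sum>k<n. reflection w i k * reflection w j k) = (if i = j then 1 else 0)"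
    if "i < n" "j < n" for i j
  proof -
    \<comment> \<open>Only the terms with \<open>k = i\<close>, with \<open>k = j\<close> and the square of \<open>w k\<close> survive the summation over \<open>k\<close>.\<close>
    have "reflection w i k * reflection w j k =
        (if k = i then (if i = j then 1 else 0) - 2 * w j * w i else 0)
        - (if k = j then 2 * w i * w j else 0) + 4 * w i * w j * (w k * w k)" for k
      by (auto simp: reflection_def algebra_simps)
    then have "(\<Sum>k<n. reflection w i k * reflection w j k) =
        (if i = j then 1 else 0) - 2 * w j * w i - 2 * w i * w j + 4 * w i * w j * dot n w w"
      using that by (simp add: sum.distrib sum_subtractf dot_def sum_distrib_left)
    then show ?thesis using assms by simp
  qed
  moreover have "reflection w k i = reflection w i k" for i k
    by (simp add: reflection_def)
  ultimately show ?thesis by (simp add: orthogonal_mat_def)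
qed

lemma dot_reflection:
  "dot n u (mat_app n (reflection w) \<theta>) = dot n u \<theta> - 2 * dot n u w * dot n w \<theta>"
proof -
  have "mat_app n (reflection w) \<theta> i = \<theta> i - 2 * w i * dot n w \<theta>" if "i < n" for i
  proof -
    have "mat_app n (reflection w) \<theta> i = (\<Sum>j<n. (if i = j then \<theta> j else 0) - 2 * w i * (w j * \<theta> j))"
      unfolding mat_app_def using that
      by (simp, intro sum.cong) (auto simp: reflection_def algebra_simps)
    then show ?thesis using that by (simp add: sum_subtractf dot_def sum_distrib_left)
  qed
  then have "dot n u (mat_app n (reflection w) \<theta>) = (\<Sum>i<n. u i * \<theta> i - 2 * dot n w \<theta> * (u i * w i))"
    unfolding dot_def[of n u] by (intro sum.cong refl) (simp add: right_diff_distrib)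
  then show ?thesis by (simp add: sum_subtractf dot_def[of n u] sum_distrib_left algebra_simps)
qed

section \<open>Integration over the sphere\<close>

locale invariant_sphere =
  fixes n :: nat and \<sigma> :: "(nat \<Rightarrow> real) measure"
  assumes n_pos: "n \<ge> 1" and uniform: "uniform_sphere_measure n \<sigma>"
begin

sublocale prob_space \<sigma>
  using uniform unfolding uniform_sphere_measure_def by blast

lemma space_sphere: "space \<sigma> = unit_sphere n"
  using uniform unfolding uniform_sphere_measure_def by blast

lemma sets_sphere: "sets \<sigma> = sets (restrict_space (borel_vec n) (unit_sphere n))"
  using uniform unfolding uniform_sphere_measure_def by blast

lemma distr_orthogonal: "orthogonal_mat n Q \<Longrightarrow> distr \<sigma> \<sigma> (mat_app n Q) = \<sigma>"
  using uniform unfolding uniform_sphere_measure_def by blast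

lemma measurable_sphere: "f \<in> borel_vec n \<rightarrow>\<^sub>M N \<Longrightarrow> f \<in> \<sigma> \<rightarrow>\<^sub>M N"
  using measurable_restrict_space1[of f "borel_vec n" N "unit_sphere n"]
    measurable_cong_sets[OF sets_sphere refl, of N] by blast

lemma dot_measurable_sphere [measurable]: "dot n x \<in> borel_measurable \<sigma>"
  by (intro measurable_sphere dot_meas)

lemma dot_self_sphere: "\<theta> \<in> space \<sigma> \<Longrightarrow> dot n \<theta> \<theta> = 1"
  by (auto simp: space_sphere unit_sphere_def L2_set_def dot_def power2_eq_square)

lemma coord_le_1: "\<theta> \<in> space \<sigma> \<Longrightarrow> i < n \<Longrightarrow> \<bar>\<theta> i\<bar> \<le> 1"
  using member_le_sum[of i "{..<n}" "\<lambda>i. \<theta> i * \<theta> i"] dot_self_sphere[of \<theta>]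
  by (auto simp: dot_def power2_eq_square abs_square_le_1[symmetric])

lemma dot_bounded: "\<theta> \<in> space \<sigma> \<Longrightarrow> \<bar>dot n x \<theta>\<bar> \<le> (\<Sum>i<n. \<bar>x i\<bar>)"
  unfolding dot_def
  by (intro order_trans[OF sum_abs] sum_mono) (auto simp: abs_mult coord_le_1 mult_left_le)

text \<open>
  On the sphere the two inner products range over a compact square, so continuity alone gives
  boundedness. The integrands below are sums of such functions.
\<close>

lemma integrable_continuous_dot2:
  assumes "continuous_on UNIV g"
  shows "integrable \<sigma> (\<lambda>\<theta>. g (dot n x \<theta>, dot n y \<theta>) :: real)"
proof -
  define B where "B = (\<Sum>i<n. \<bar>x i\<bar>) + (\<Sum>i<n. \<bar>y i\<bar>)"
  have "compact (g ` ({-B..B} \<times> {-B..B}))"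
    by (intro compact_continuous_image compact_Times continuous_on_subset[OF assms]) auto
  then obtain C where C: "\<And>z. z \<in> g ` ({-B..B} \<times> {-B..B}) \<Longrightarrow> norm z \<le> C"
    using compact_imp_bounded bounded_iff by metis
  have [measurable]: "g \<in> borel_measurable borel"
    using assms by (rule borel_measurable_continuous_onI)
  have "norm (g (dot n x \<theta>, dot n y \<theta>)) \<le> C" if "\<theta> \<in> space \<sigma>" for \<theta>
  proof -
    have "0 \<le> (\<Sum>i<n. \<bar>x i\<bar>)" "0 \<le> (\<Sum>i<n. \<bar>y i\<bar>)" by (auto intro: sum_nonneg)
    then have "\<bar>dot n x \<theta>\<bar> \<le> B" "\<bar>dot n y \<theta>\<bar> \<le> B"
      using dot_bounded[OF that, of x] dot_bounded[OF that, of y] by (simp_all add: B_def)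
    then show ?thesis by (intro C imageI) auto
  qed
  then show ?thesis
    by (intro integrable_const_bound[of _ C]) auto
qed

lemma integrable_abs_dot_mult: "integrable \<sigma> (\<lambda>\<theta>. \<bar>dot n x \<theta>\<bar> * \<bar>dot n y \<theta>\<bar>)"
proof -
  have "continuous_on UNIV (\<lambda>z::real \<times> real. \<bar>fst z\<bar> * \<bar>snd z\<bar>)" by (intro continuous_intros)
  from integrable_continuous_dot2[OF this, of x y] show ?thesis by simp
qed

lemma integrable_dot_square: "integrable \<sigma> (\<lambda>\<theta>. (dot n x \<theta>)\<^sup>2)"
  using integrable_abs_dot_mult[of x x] by (simp add: power2_eq_square)

lemma integrable_abs_dot: "integrable \<sigma> (\<lambda>\<theta>. \<bar>dot n x \<theta>\<bar>)"
proof -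
  have "continuous_on UNIV (\<lambda>z::real \<times> real. \<bar>fst z\<bar>)" by (intro continuous_intros)
  from integrable_continuous_dot2[OF this, of x x] show ?thesis by simp
qed

lemma integral_reflection:
  assumes "dot n w w = 1" and g: "g \<in> borel_measurable \<sigma>"
  shows "(\<integral>\<theta>. g (mat_app n (reflection w) \<theta>) \<partial>\<sigma>) = (\<integral>\<theta>. (g \<theta> :: real) \<partial>\<sigma>)"
proof -
  let ?T = "mat_app n (reflection w)"
  have T: "?T \<in> \<sigma> \<rightarrow>\<^sub>M \<sigma>"
  proof -
    have "?T \<in> borel_vec n \<rightarrow>\<^sub>M borel_vec n" by (rule mat_app_meas)
    moreover have "?T \<theta> \<in> unit_sphere n" if "\<theta> \<in> unit_sphere n" for \<theta>
      using that mat_app_norm[OF orthogonal_reflection[OF assms(1)]] mat_app_space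
      by (auto simp: unit_sphere_def)
    ultimately have "?T \<in> \<sigma> \<rightarrow>\<^sub>M restrict_space (borel_vec n) (unit_sphere n)"
      by (intro measurable_restrict_space2 measurable_sphere) (auto simp: space_sphere)
    then show ?thesis
      using measurable_cong_sets[OF refl sets_sphere, of \<sigma>] by blast
  qed
  have "(\<integral>\<theta>. g \<theta> \<partial>distr \<sigma> \<sigma> ?T) = (\<integral>\<theta>. g (?T \<theta>) \<partial>\<sigma>)"
    by (rule integral_distr[OF T g])
  then show ?thesis
    by (simp only: distr_orthogonal[OF orthogonal_reflection[OF assms(1)]])
qed

text \<open>
  If \<open>u\<close> and \<open>v\<close> have the same length, the reflection in the direction \<open>u - v\<close> exchanges them, and
  it preserves \<open>\<sigma>\<close>.
\<close>

lemma integral_dot_cong: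
  assumes eq: "dot n u u = dot n v v" and g: "g \<in> borel_measurable borel"
  shows "(\<integral>\<theta>. g (dot n u \<theta>) \<partial>\<sigma>) = (\<integral>\<theta>. (g (dot n v \<theta>) :: real) \<partial>\<sigma>)"
proof -
  define d where "d = (\<lambda>i. u i - v i)"
  have dd: "dot n d d = 2 * dot n u d"
    unfolding d_def dot_diff using eq
    by (simp add: dot_commute[of n _ "\<lambda>i. u i - v i"] dot_diff dot_commute[of n v u])
  show ?thesis
  proof (cases "dot n d d = 0")
    case True
    then have "\<forall>i<n. u i = v i"
      by (simp add: dot_def d_def sum_nonneg_eq_0_iff)
    then have "dot n u = dot n v" by (auto intro!: dot_cong)
    then show ?thesis by simp
  next
    case False
    then have pos: "0 < dot n d d" using dot_nonneg[of n d] by simp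
    define c where "c = inverse (sqrt (dot n d d))"
    define w where "w = (\<lambda>i. c * d i)"
    have cc: "c * c * dot n d d = 1"
      using pos by (simp add: c_def flip: inverse_mult_distrib)
    have ww: "dot n w w = 1"
      unfolding w_def dot_scale dot_scale_right using cc by (simp add: mult_ac)
    have "2 * dot n u w * dot n w \<theta> = dot n d \<theta>" for \<theta>
    proof -
      have "2 * dot n u w * dot n w \<theta> = (c * c * (2 * dot n u d)) * dot n d \<theta>"
        unfolding w_def dot_scale dot_scale_right by (simp add: mult_ac)
      then show ?thesis using cc unfolding dd by simp
    qed
    then have *: "dot n u (mat_app n (reflection w) \<theta>) = dot n v \<theta>" for \<theta>
      by (simp add: dot_reflection) (simp add: d_def dot_diff)
    have "(\<lambda>\<theta>. g (dot n u \<theta>)) \<in> borel_measurable \<sigma>" using g by measurable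
    from integral_reflection[OF ww this] show ?thesis by (simp add: *)
  qed
qed

text \<open>
  By invariance \<open>u\<close> can be replaced by a multiple of any of the \<open>n\<close> coordinate vectors, and the
  squares of the coordinates of a unit vector add up to 1.
\<close>

lemma integral_dot_square: "(\<integral>\<theta>. (dot n u \<theta>)\<^sup>2 \<partial>\<sigma>) = dot n u u / n"
proof -
  \<comment> \<open>The vector \<open>e i\<close> has the length of \<open>u\<close> and points along the \<open>i\<close>-th axis.\<close>
  define e :: "nat \<Rightarrow> nat \<Rightarrow> real" where "e = (\<lambda>i j. if j = i then sqrt (dot n u u) else 0 :: real)"
  have de: "dot n (e i) z = sqrt (dot n u u) * z i" if "i < n" for i z
  proof -
    have "dot n (e i) z = (\<Sum>j<n. if j = i then sqrt (dot n u u) * z j else 0)"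
      unfolding dot_def e_def by (intro sum.cong) auto
    then show ?thesis using that by simp
  qed
  have ee: "dot n (e i) (e i) = dot n u u" if "i < n" for i
    by (simp add: de[OF that]) (simp add: e_def dot_nonneg)
  have "(\<integral>\<theta>. (dot n u \<theta>)\<^sup>2 \<partial>\<sigma>) = (\<integral>\<theta>. (dot n (e i) \<theta>)\<^sup>2 \<partial>\<sigma>)" if "i < n" for i
    by (rule integral_dot_cong[where g = "\<lambda>t. t\<^sup>2"]) (simp_all add: ee[OF that])
  then have "(\<Sum>i<n. (\<integral>\<theta>. (dot n u \<theta>)\<^sup>2 \<partial>\<sigma>)) = (\<Sum>i<n. (\<integral>\<theta>. (dot n (e i) \<theta>)\<^sup>2 \<partial>\<sigma>))"
    by (intro sum.cong refl) simp
  also have "\<dots> = (\<integral>\<theta>. (\<Sum>i<n. (dot n (e i) \<theta>)\<^sup>2) \<partial>\<sigma>)"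
    by (intro Bochner_Integration.integral_sum[symmetric] integrable_dot_square)
  also have "\<dots> = (\<integral>\<theta>. dot n u u \<partial>\<sigma>)"
  proof (rule Bochner_Integration.integral_cong)
    fix \<theta> assume "\<theta> \<in> space \<sigma>"
    have "(\<Sum>i<n. (dot n (e i) \<theta>)\<^sup>2) = dot n u u * dot n \<theta> \<theta>"
    proof -
      have "(dot n (e i) \<theta>)\<^sup>2 = dot n u u * (\<theta> i * \<theta> i)" if "i < n" for i
        by (simp add: de[OF that] power_mult_distrib dot_nonneg) (simp add: power2_eq_square)
      then show ?thesis by (simp add: dot_def[of n \<theta>] sum_distrib_left)
    qed
    then show "(\<Sum>i<n. (dot n (e i) \<theta>)\<^sup>2) = dot n u u"
      using dot_self_sphere \<open>\<theta> \<in> space \<sigma>\<close> by simp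
  qed simp
  finally show ?thesis using n_pos by (simp add: prob_space field_simps)
qed

definition mean_abs :: real where
  "mean_abs = (\<integral>\<theta>. \<bar>\<theta> 0\<bar> \<partial>\<sigma>)"

lemma integral_abs_dot: "(\<integral>\<theta>. \<bar>dot n u \<theta>\<bar> \<partial>\<sigma>) = sqrt (dot n u u) * mean_abs"
proof -
  define e :: "nat \<Rightarrow> real" where "e = (\<lambda>j. if j = 0 then sqrt (dot n u u) else 0 :: real)"
  have de: "dot n e z = sqrt (dot n u u) * z 0" for z
  proof -
    have "dot n e z = (\<Sum>j<n. if j = 0 then sqrt (dot n u u) * z j else 0)"
      unfolding dot_def e_def by (intro sum.cong) auto
    then show ?thesis using n_pos by simp
  qed
  have ee: "dot n e e = dot n u u"
    by (simp add: de) (simp add: e_def dot_nonneg)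
  have "(\<integral>\<theta>. \<bar>dot n u \<theta>\<bar> \<partial>\<sigma>) = (\<integral>\<theta>. \<bar>dot n e \<theta>\<bar> \<partial>\<sigma>)"
    by (rule integral_dot_cong[where g = "\<lambda>t. \<bar>t\<bar>"]) (simp_all add: ee)
  then show ?thesis by (simp add: de abs_mult dot_nonneg mean_abs_def)
qed

end

section \<open>The arcsine kernel and elementary inequalities\<close>

lemma integral_shift_interval:
  fixes f :: "real \<Rightarrow> real"
  assumes "continuous_on UNIV f"
  shows "integral {a..b} (\<lambda>t. f (t + c)) = integral {a + c..b + c} f"
proof -
  have "(f has_integral integral {a + c..b + c} f) {a + c..b + c}"
    by (intro integrable_integral integrable_continuous_interval continuous_on_subset[OF assms]) auto
  then have "((f \<circ> (+) c) has_integral integral {a + c..b + c} f) {a..b}"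
    using has_integral_shift_cbox_iff[of f c "integral {a + c..b + c} f" a b] by (simp add: add.commute)
  then show ?thesis by (simp add: o_def add.commute integral_unique)
qed

text \<open>
  The part of the shifted window to the left of 0 is moved by one period to the right end.
\<close>

lemma integral_periodic_shift:
  fixes f :: "real \<Rightarrow> real"
  assumes cont: "continuous_on UNIV f" and per: "\<And>t. f (t + T) = f t" and c: "0 \<le> c" "c \<le> T"
  shows "integral {0..T} (\<lambda>t. f (t - c)) = integral {0..T} f"
proof -
  have int: "f integrable_on {a..b}" for a b
    by (intro integrable_continuous_interval continuous_on_subset[OF cont]) auto
  have "integral {0..T} (\<lambda>t. f (t - c)) = integral {-c..T - c} f"
    using integral_shift_interval[OF cont, of 0 T "-c"] by simp
  also have "\<dots> = integral {-c..0} f + integral {0..T - c} f"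
    using c by (intro Henstock_Kurzweil_Integration.integral_combine[symmetric] int) auto
  also have "integral {-c..0} f = integral {T - c..T} f"
    using integral_shift_interval[OF cont, of "-c" 0 T] by (simp add: per)
  also have "integral {T - c..T} f + integral {0..T - c} f = integral {0..T} f"
    using c Henstock_Kurzweil_Integration.integral_combine[of 0 "T - c" T f] int by simp
  finally show ?thesis .
qed

text \<open>
  Up to the factor \<open>2 / \<pi>\<close> this is \<open>E \<bar>X Y\<bar>\<close> for standard Gaussian variables \<open>X, Y\<close> with correlation \<open>\<rho>\<close>.
  Its derivative is \<open>arcsin\<close>, whence the expansion \<open>1 + \<rho>\<^sup>2 / 2 + \<rho>\<^sup>4 / 24 + \<dots>\<close>.
\<close>

definition arcsine_kernel :: "real \<Rightarrow> real" where
  "arcsine_kernel \<rho> = sqrt (1 - \<rho>\<^sup>2) + \<rho> * arcsin \<rho>"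

lemma integral_abs_add_cos:
  assumes "\<bar>\<rho>\<bar> \<le> 1"
  shows "integral {0..2 * pi} (\<lambda>t. \<bar>\<rho> + cos t\<bar>) = 4 * arcsine_kernel \<rho>"
proof -
  \<comment> \<open>The integrand changes its sign at \<open>\<alpha>\<close> and at \<open>2 * pi - \<alpha>\<close>.\<close>
  define \<alpha> where "\<alpha> = arccos (- \<rho>)"
  have \<alpha>: "0 \<le> \<alpha>" "\<alpha> \<le> pi" "cos \<alpha> = - \<rho>" "sin \<alpha> = sqrt (1 - \<rho>\<^sup>2)"
    using assms arccos_lbound[of "-\<rho>"] arccos_ubound[of "-\<rho>"] sin_arccos_abs[of "-\<rho>"]
    by (auto simp: \<alpha>_def abs_le_iff)
  have \<alpha>': "\<alpha> = pi / 2 + arcsin \<rho>"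
    using assms arccos_arcsin_eq[of "-\<rho>"] arcsin_minus[of \<rho>] by (auto simp: \<alpha>_def abs_le_iff)
  let ?F = "\<lambda>t. \<rho> * t + sin t"
  have up: "((\<lambda>t. \<bar>\<rho> + cos t\<bar>) has_integral (?F b - ?F a)) {a..b}"
    if "a \<le> b" "\<And>t. a \<le> t \<Longrightarrow> t \<le> b \<Longrightarrow> 0 \<le> \<rho> + cos t" for a b
  proof -
    have "((\<lambda>t. \<rho> + cos t) has_integral (?F b - ?F a)) {a..b}"
      using that(1) by (intro fundamental_theorem_of_calculus)
        (auto intro!: derivative_eq_intros simp flip: has_real_derivative_iff_has_vector_derivative)
    then show ?thesis by (rule has_integral_eq[rotated]) (simp add: that(2))
  qed
  have down: "((\<lambda>t. \<bar>\<rho> + cos t\<bar>) has_integral (?F a - ?F b)) {a..b}"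
    if "a \<le> b" "\<And>t. a \<le> t \<Longrightarrow> t \<le> b \<Longrightarrow> \<rho> + cos t \<le> 0" for a b
  proof -
    have "((\<lambda>t. - (\<rho> + cos t)) has_integral ((- ?F b) - (- ?F a))) {a..b}"
      using that(1) by (intro fundamental_theorem_of_calculus)
        (auto intro!: derivative_eq_intros simp flip: has_real_derivative_iff_has_vector_derivative)
    then have "((\<lambda>t. - (\<rho> + cos t)) has_integral (?F a - ?F b)) {a..b}"
      by (simp add: algebra_simps)
    then show ?thesis by (rule has_integral_eq[rotated]) (simp add: abs_of_nonpos that(2))
  qed
  have refl: "cos (2 * pi - t) = cos t" for t :: real by (simp add: cos_diff)
  have 1: "((\<lambda>t. \<bar>\<rho> + cos t\<bar>) has_integral (?F \<alpha> - ?F 0)) {0..\<alpha>}"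
  proof (rule up)
    fix t assume "0 \<le> t" "t \<le> \<alpha>"
    then show "0 \<le> \<rho> + cos t" using \<alpha> cos_monotone_0_pi_le[of t \<alpha>] by simp
  qed (rule \<alpha>)
  have 2: "((\<lambda>t. \<bar>\<rho> + cos t\<bar>) has_integral (?F \<alpha> - ?F (2 * pi - \<alpha>))) {\<alpha>..2 * pi - \<alpha>}"
  proof (rule down)
    fix t assume t: "\<alpha> \<le> t" "t \<le> 2 * pi - \<alpha>"
    show "\<rho> + cos t \<le> 0"
    proof (cases "t \<le> pi")
      case True
      then show ?thesis using t \<alpha> cos_monotone_0_pi_le[of \<alpha> t] by simp
    next
      case False
      then show ?thesis using t \<alpha> cos_monotone_0_pi_le[of \<alpha> "2 * pi - t"] refl[of t] by simp
    qed
  qed (use \<alpha> in simp)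
  have 3: "((\<lambda>t. \<bar>\<rho> + cos t\<bar>) has_integral (?F (2 * pi) - ?F (2 * pi - \<alpha>))) {2 * pi - \<alpha>..2 * pi}"
  proof (rule up)
    fix t assume "2 * pi - \<alpha> \<le> t" "t \<le> 2 * pi"
    then show "0 \<le> \<rho> + cos t" using \<alpha> cos_monotone_0_pi_le[of "2 * pi - t" \<alpha>] refl[of t] by simp
  qed (use \<alpha> in simp)
  have "((\<lambda>t. \<bar>\<rho> + cos t\<bar>) has_integral (?F \<alpha> - ?F 0 + (?F \<alpha> - ?F (2 * pi - \<alpha>)))) {0..2 * pi - \<alpha>}"
    using \<alpha> by (intro has_integral_combine[OF _ _ 1 2]) auto
  from has_integral_combine[OF _ _ this 3]
  have "integral {0..2 * pi} (\<lambda>t. \<bar>\<rho> + cos t\<bar>)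
      = ?F \<alpha> - ?F 0 + (?F \<alpha> - ?F (2 * pi - \<alpha>)) + (?F (2 * pi) - ?F (2 * pi - \<alpha>))"
    using \<alpha> by (intro integral_unique) auto
  also have "\<dots> = 4 * arcsine_kernel \<rho>"
    unfolding arcsine_kernel_def \<alpha>(4)[symmetric] by (simp add: sin_diff) (simp add: \<alpha>' algebra_simps)
  finally show ?thesis .
qed

text \<open>
  The coefficient 30 is that of the second derivative of \<open>\<rho> ^ 6\<close>, which is the error term of the
  arcsine kernel; here \<open>v = \<rho>\<^sup>2\<close>.
\<close>

lemma inverse_sqrt_le:
  fixes v :: real
  assumes "0 \<le> v" "v \<le> 1 / 4"
  shows "inverse (sqrt (1 - v)) \<le> 1 + v / 2 + 30 * v\<^sup>2"
proof -
  have "0 \<le> v * v * (59 - 60 * v)" using assms by (intro mult_nonneg_nonneg) auto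
  then have "1 \<le> (1 + v + 60 * v\<^sup>2) * (1 - v)"
    by (simp add: algebra_simps power2_eq_square)
  also have "\<dots> \<le> (1 + v / 2 + 30 * v\<^sup>2)\<^sup>2 * (1 - v)"
  proof (rule mult_right_mono)
    have "(1 + v / 2 + 30 * v\<^sup>2)\<^sup>2 = 1 + v + 60 * v\<^sup>2 + (v / 2 + 30 * v\<^sup>2)\<^sup>2"
      by (simp add: power2_eq_square algebra_simps)
    then show "1 + v + 60 * v\<^sup>2 \<le> (1 + v / 2 + 30 * v\<^sup>2)\<^sup>2" by simp
  qed (use assms in simp)
  finally have "sqrt 1 \<le> sqrt ((1 + v / 2 + 30 * v\<^sup>2)\<^sup>2 * (1 - v))"
    by (rule real_sqrt_le_mono)
  also have "\<dots> = (1 + v / 2 + 30 * v\<^sup>2) * sqrt (1 - v)"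
    using assms by (simp add: real_sqrt_mult)
  finally show ?thesis using assms by (simp add: inverse_eq_divide divide_le_eq)
qed

lemma arcsin_le:
  fixes x :: real
  assumes "0 \<le> x" "x \<le> 1 / 2"
  shows "arcsin x \<le> x + x ^ 3 / 6 + 6 * x ^ 5"
proof -
  let ?g = "\<lambda>x::real. x + x ^ 3 / 6 + 6 * x ^ 5 - arcsin x"
  have "?g 0 \<le> ?g x"
  proof (rule DERIV_nonneg_imp_nondecreasing[OF assms(1)])
    fix y :: real assume y: "0 \<le> y" "y \<le> x"
    have "y\<^sup>2 \<le> (1/2)\<^sup>2" using y assms by (intro power_mono) auto
    then have "inverse (sqrt (1 - y\<^sup>2)) \<le> 1 + y\<^sup>2 / 2 + 30 * (y\<^sup>2)\<^sup>2"
      by (intro inverse_sqrt_le) (auto simp: power2_eq_square)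
    moreover have "(?g has_real_derivative (1 + y\<^sup>2 / 2 + 30 * (y\<^sup>2)\<^sup>2 - inverse (sqrt (1 - y\<^sup>2)))) (at y)"
      using y assms by (auto intro!: derivative_eq_intros simp flip: power_mult)
    ultimately show "\<exists>d. (?g has_real_derivative d) (at y) \<and> d \<ge> 0"
      by (intro exI conjI) auto
  qed
  then show ?thesis by simp
qed

text \<open>
  Restricting \<open>\<rho>\<close> keeps the remainder away from the singularity of \<open>arcsin\<close> at 1. The estimate is
  integrated twice from a bound for \<open>1 / sqrt (1 - \<rho>\<^sup>2)\<close>, the second derivative of the kernel.
\<close>

lemma arcsine_kernel_le:
  assumes "\<bar>\<rho>\<bar> \<le> 1 / 2"
  shows "arcsine_kernel \<rho> \<le> 1 + \<rho>\<^sup>2 / 2 + \<rho> ^ 4 / 24 + \<rho> ^ 6"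
proof -
  have even: "arcsine_kernel \<rho> = arcsine_kernel \<bar>\<rho>\<bar>"
    using assms by (cases "\<rho> \<ge> 0") (auto simp: arcsine_kernel_def arcsin_minus)
  let ?g = "\<lambda>x::real. 1 + x\<^sup>2 / 2 + x ^ 4 / 24 + x ^ 6 - arcsine_kernel x"
  have "?g 0 \<le> ?g \<bar>\<rho>\<bar>"
  proof (rule DERIV_nonneg_imp_nondecreasing[where f = ?g and a = 0 and b = "\<bar>\<rho>\<bar>"])
    fix y :: real assume y: "0 \<le> y" "y \<le> \<bar>\<rho>\<bar>"
    have "y\<^sup>2 \<le> (1/2)\<^sup>2" using y assms by (intro power_mono) auto
    then have p: "0 < 1 - y\<^sup>2" by (simp add: power2_eq_square)
    have "(arcsine_kernel has_real_derivative arcsin y) (at y)"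
      unfolding arcsine_kernel_def[abs_def] using y assms p
      by (auto intro!: derivative_eq_intros simp: field_simps)
    then have "(?g has_real_derivative (y + y ^ 3 / 6 + 6 * y ^ 5 - arcsin y)) (at y)"
      by (auto intro!: derivative_eq_intros)
    moreover have "arcsin y \<le> y + y ^ 3 / 6 + 6 * y ^ 5"
      using y assms by (intro arcsin_le) auto
    ultimately show "\<exists>d. (?g has_real_derivative d) (at y) \<and> d \<ge> 0"
      by (intro exI conjI) auto
  qed auto
  then have "arcsine_kernel \<bar>\<rho>\<bar> \<le> 1 + \<rho>\<^sup>2 / 2 + \<rho> ^ 4 / 24 + \<rho> ^ 6"
    by (simp add: arcsine_kernel_def)
  then show ?thesis by (simp add: even)
qed

text \<open>
  The polynomial is the Taylor polynomial of degree 5 of the square root at 1. Odd degree makes it an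
  upper bound on the whole half-line, and degree 5 is what an error of order \<open>1 / n ^ 3\<close> requires when \<open>y\<close> is
  \<open>\<bar>G\<bar>\<^sup>2 / n\<close> for a Gaussian vector \<open>G\<close>: its fourth central moment is still of order \<open>1 / n ^ 2\<close>.
\<close>

lemma sqrt_le_taylor5:
  fixes y :: real
  assumes "0 \<le> y"
  shows "sqrt y \<le> (63 + 315 * y - 210 * y ^ 2 + 126 * y ^ 3 - 45 * y ^ 4 + 7 * y ^ 5) / 256"
proof -
  define u where "u = sqrt y"
  have u: "0 \<le> u" "y = u\<^sup>2" using assms by (auto simp: u_def)
  \<comment> \<open>The remainder vanishes to order 6 at 1, and its cofactor has positive coefficients only.\<close>
  have "0 \<le> (u - 1) ^ 6 * (63 + 122 * u + 102 * u ^ 2 + 42 * u ^ 3 + 7 * u ^ 4)"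
    using u by (intro mult_nonneg_nonneg add_nonneg_nonneg) auto
  also have "\<dots> = (63 + 315 * y - 210 * y ^ 2 + 126 * y ^ 3 - 45 * y ^ 4 + 7 * y ^ 5) - 256 * u"
    unfolding u(2) by algebra
  finally show ?thesis by (simp add: u_def)
qed

text \<open>
  The Taylor polynomial at 0 of odd degree, which bounds the function from below for negative \<open>d\<close> as well.
\<close>

lemma inverse_square_ge:
  fixes d :: real
  assumes "d < 1"
  shows "1 + 2 * d + 3 * d\<^sup>2 + 4 * d ^ 3 \<le> 1 / (1 - d)\<^sup>2"
proof -
  have "(1 + 2 * d + 3 * d\<^sup>2 + 4 * d ^ 3) * (1 - d)\<^sup>2 = 1 - d ^ 4 * (5 - 4 * d)"
    by algebra
  also have "\<dots> \<le> 1" using assms by simp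
  finally show ?thesis using assms by (simp add: le_divide_eq)
qed

section \<open>Gaussian vectors\<close>

definition std_normal :: "real measure" where
  "std_normal = density lborel (normal_density 0 1)"

definition gauss :: "nat \<Rightarrow> (nat \<Rightarrow> real) measure" where
  "gauss n = PiM {..<n} (\<lambda>_. std_normal)"

lemma prob_space_std_normal: "prob_space std_normal"
  unfolding std_normal_def by (rule prob_space_normal_density) simp

lemma prob_space_gauss: "prob_space (gauss n)"
  unfolding gauss_def by (rule prob_space_PiM) (rule prob_space_std_normal)

lemma sets_std_normal [measurable_cong]: "sets std_normal = sets borel"
  by (simp add: std_normal_def)

lemma sets_gauss [measurable_cong]: "sets (gauss n) = sets (borel_vec n)"
  unfolding gauss_def borel_vec_def by (rule sets_PiM_cong) (auto simp: sets_std_normal)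

lemma coord_gauss [measurable]: "i < n \<Longrightarrow> (\<lambda>x. x i) \<in> borel_measurable (gauss n)"
  by (simp add: coord_meas measurable_cong_sets[OF sets_gauss refl])

lemma distr_coord_gauss: "i < n \<Longrightarrow> distr (gauss n) borel (\<lambda>x. x i) = std_normal"
proof -
  assume "i < n"
  then have "distr (gauss n) std_normal (\<lambda>x. x i) = std_normal"
    unfolding gauss_def by (intro distr_PiM_component prob_space_std_normal) auto
  then show ?thesis by (simp add: distr_cong[OF refl sets_std_normal[symmetric] refl])
qed

text \<open>
  The product measure is the joint law of its coordinates, which is the criterion for independence.
\<close>

lemma indep_coord_gauss: "prob_space.indep_vars (gauss n) (\<lambda>_. borel) (\<lambda>i x. x i) {..<n}"
proof (cases "n = 0")
  case True
  then show ?thesis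
    using prob_space_gauss[of n] by (simp add: prob_space.indep_vars_def prob_space.indep_sets_def)
next
  case False
  have "distr (gauss n) (PiM {..<n} (\<lambda>_. borel)) (\<lambda>x. \<lambda>i\<in>{..<n}. x i) = distr (gauss n) (gauss n) (\<lambda>x. x)"
  proof (rule distr_cong)
    fix x assume "x \<in> space (gauss n)"
    then show "(\<lambda>i\<in>{..<n}. x i) = x"
      by (auto simp: gauss_def space_PiM PiE_def extensional_def fun_eq_iff)
  qed (simp_all add: sets_gauss borel_vec_def)
  also have "\<dots> = gauss n" by (rule distr_id)
  also have "\<dots> = PiM {..<n} (\<lambda>i. distr (gauss n) borel (\<lambda>x. x i))"
    unfolding gauss_def by (rule PiM_cong) (simp_all flip: gauss_def add: distr_coord_gauss)
  finally show ?thesis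
    using False by (subst prob_space.indep_vars_iff_distr_eq_PiM'[OF prob_space_gauss]) auto
qed

lemma distributed_coord_gauss:
  "i < n \<Longrightarrow> distributed (gauss n) lborel (\<lambda>x. x i) (normal_density 0 1)"
  unfolding distributed_def
  by (simp add: distr_coord_gauss std_normal_def distr_cong[OF refl sets_lborel refl])

text \<open>
  Rotation invariance of the Gaussian measure in the form that is needed: every one-dimensional
  marginal in a unit direction is standard normal.
\<close>

lemma distributed_dot_gauss:
  assumes "dot n \<theta> \<theta> = 1"
  shows "distributed (gauss n) lborel (\<lambda>x. dot n \<theta> x) (normal_density 0 1)"
proof -
  interpret prob_space "gauss n" by (rule prob_space_gauss)
  \<comment> \<open>The coordinates with coefficient 0 are dropped, as they do not have a density after scaling.\<close>
  define I where "I = {i. i < n \<and> \<theta> i \<noteq> 0}"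
  have on_I: "(\<Sum>i\<in>I. \<theta> i * z i) = dot n \<theta> z" for z
    unfolding dot_def by (rule sum.mono_neutral_left) (auto simp: I_def)
  have "I \<noteq> {}" using on_I[of \<theta>] assms by auto
  then have I: "finite I" "I \<noteq> {}" "I \<subseteq> {..<n}" by (auto simp: I_def)
  have "indep_vars (\<lambda>_. borel) (\<lambda>i. (\<lambda>t. \<theta> i * t) \<circ> (\<lambda>x. x i)) I"
    by (rule indep_vars_compose[OF indep_vars_subset[OF indep_coord_gauss I(3)]]) auto
  then have indep: "indep_vars (\<lambda>_. borel) (\<lambda>i x. \<theta> i * x i) I" by (simp add: o_def)
  have "distributed (gauss n) lborel (\<lambda>x. \<theta> i * x i) (normal_density 0 \<bar>\<theta> i\<bar>)" if "i \<in> I" for i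
    using normal_density_affine[OF distributed_coord_gauss[of i n], where \<alpha> = "\<theta> i" and \<beta> = 0] that by (auto simp: I_def)
  then have "distributed (gauss n) lborel (\<lambda>x. \<Sum>i\<in>I. \<theta> i * x i)
      (normal_density (\<Sum>i\<in>I. 0) (sqrt (\<Sum>i\<in>I. \<bar>\<theta> i\<bar>\<^sup>2)))"
    by (intro sum_indep_normal I indep) (auto simp: I_def)
  also have "(\<Sum>i\<in>I. \<bar>\<theta> i\<bar>\<^sup>2) = 1"
    using on_I[of \<theta>] assms by (simp add: power2_eq_square)
  finally show ?thesis by (simp add: on_I)
qed

lemma gauss_abs_dot:
  assumes "dot n \<theta> \<theta> = 1"
  shows "has_bochner_integral (gauss n) (\<lambda>x. \<bar>dot n \<theta> x\<bar>) (sqrt (2 / pi))"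
proof -
  have "has_bochner_integral lborel (\<lambda>x. std_normal_density x * \<bar>x\<bar>) (sqrt (2 / pi))"
    using std_normal_moment_abs_odd[of 0] by simp
  then show ?thesis
    using distributed_integrable[OF distributed_dot_gauss[OF assms], of abs]
      distributed_integral[OF distributed_dot_gauss[OF assms], of abs]
    by (simp add: has_bochner_integral_iff)
qed

lemma std_normal_even_moment:
  "fact (2 * k) / (2 ^ k * fact k) = 2 ^ k * pochhammer (1 / 2 :: real) k"
proof -
  have "2 ^ (2 * k) * pochhammer (1 / 2 :: real) k * fact k = fact (2 * k)"
    by (simp add: fact_double)
  moreover have "(2::real) ^ (2 * k) = 2 ^ k * 2 ^ k" by (simp add: mult_2 power_add)
  ultimately show ?thesis by (simp add: field_simps)
qed

lemma gauss_coord_moment: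
  assumes "i < n"
  shows "has_bochner_integral (gauss n) (\<lambda>x. (x i ^ 2) ^ k) (2 ^ k * pochhammer (1 / 2) k)"
proof -
  have "has_bochner_integral lborel (\<lambda>x. std_normal_density x * (x ^ 2) ^ k) (2 ^ k * pochhammer (1 / 2) k)"
    using std_normal_moment_even[of k] by (simp add: std_normal_even_moment power_mult)
  then show ?thesis
    using distributed_integrable[OF distributed_coord_gauss[OF assms], of "\<lambda>t. (t ^ 2) ^ k"]
      distributed_integral[OF distributed_coord_gauss[OF assms], of "\<lambda>t. (t ^ 2) ^ k"]
    by (simp add: has_bochner_integral_iff)
qed

text \<open>
  Moments of a sum of independent variables, by the binomial theorem. Inserted into the
  Vandermonde identity for rising factorials it yields the moments of \<open>\<bar>G\<bar>\<^sup>2\<close> one coordinate at a time.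
\<close>

lemma (in prob_space) indep_var_power_add:
  assumes ind: "indep_var borel X borel Y"
    and X: "\<And>k. has_bochner_integral M (\<lambda>x. X x ^ k) (a k)"
    and Y: "\<And>k. has_bochner_integral M (\<lambda>x. Y x ^ k) (b k)"
  shows "has_bochner_integral M (\<lambda>x. (X x + Y x :: real) ^ k) (\<Sum>j\<le>k. of_nat (k choose j) * a j * b (k - j))"
proof -
  have XY: "has_bochner_integral M (\<lambda>x. X x ^ j * Y x ^ l) (a j * b l)" for j l
  proof -
    have "indep_var borel ((\<lambda>t. t ^ j) \<circ> X) borel ((\<lambda>t. t ^ l) \<circ> Y)"
      by (rule indep_var_compose[OF ind]) auto
    then have ind': "indep_var borel (\<lambda>x. X x ^ j) borel (\<lambda>x. Y x ^ l)" by (simp add: o_def)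
    show ?thesis
      using indep_var_integrable[OF ind'] indep_var_lebesgue_integral[OF ind'] X[of j] Y[of l]
      by (simp add: has_bochner_integral_iff)
  qed
  have "has_bochner_integral M (\<lambda>x. \<Sum>j\<le>k. of_nat (k choose j) * (X x ^ j * Y x ^ (k - j)))
      (\<Sum>j\<le>k. of_nat (k choose j) * (a j * b (k - j)))"
    by (intro has_bochner_integral_sum has_bochner_integral_mult_right XY)
  then show ?thesis by (simp add: binomial_ring mult.assoc)
qed

lemma gauss_norm_moment:
  "has_bochner_integral (gauss n) (\<lambda>x. dot n x x ^ k) (2 ^ k * pochhammer (n / 2) k)"
proof -
  interpret prob_space "gauss n" by (rule prob_space_gauss)
  have "has_bochner_integral (gauss n) (\<lambda>x. (\<Sum>i<m. x i ^ 2) ^ k) (2 ^ k * pochhammer (m / 2) k)"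
    if "m \<le> n" for m k
    using that
  proof (induction m arbitrary: k)
    case 0
    have "has_bochner_integral (gauss n) (\<lambda>x. 0 ^ k :: real) (0 ^ k)"
      using prob_space by (simp add: has_bochner_integral_iff)
    then show ?case by (cases k) (simp_all add: pochhammer_0_left)
  next
    case (Suc m)
    have "indep_vars (\<lambda>_. borel) (\<lambda>i. (\<lambda>t. t ^ 2) \<circ> (\<lambda>x. x i)) (insert m {..<m})"
      using Suc.prems
      by (intro indep_vars_compose[OF indep_vars_subset[OF indep_coord_gauss]]) auto
    then have "indep_vars (\<lambda>_. borel) (\<lambda>i x. x i ^ 2) (insert m {..<m})"
      by (simp add: o_def)
    then have ind: "indep_var borel (\<lambda>x. x m ^ 2) borel (\<lambda>x. \<Sum>i<m. x i ^ 2 :: real)"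
      by (intro indep_vars_sum) auto
    have "has_bochner_integral (gauss n) (\<lambda>x. (x m ^ 2 + (\<Sum>i<m. x i ^ 2)) ^ k)
      (\<Sum>j\<le>k. of_nat (k choose j) * (2 ^ j * pochhammer (1 / 2) j) * (2 ^ (k - j) * pochhammer (m / 2) (k - j)))"
      using Suc by (intro indep_var_power_add[OF ind] gauss_coord_moment) auto
    also have "(\<Sum>j\<le>k. of_nat (k choose j) * (2 ^ j * pochhammer (1 / 2) j) * (2 ^ (k - j) * pochhammer (m / 2) (k - j)))
      = 2 ^ k * (\<Sum>j\<le>k. of_nat (k choose j) * pochhammer (1 / 2 :: real) j * pochhammer (m / 2) (k - j))"
      unfolding sum_distrib_left
    proof (rule sum.cong)
      fix j assume "j \<in> {..k}"
      then have "(2::real) ^ k = 2 ^ j * 2 ^ (k - j)" by (simp flip: power_add)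
      then show "of_nat (k choose j) * (2 ^ j * pochhammer (1 / 2 :: real) j) * (2 ^ (k - j) * pochhammer (m / 2) (k - j))
        = 2 ^ k * (of_nat (k choose j) * pochhammer (1 / 2) j * pochhammer (m / 2) (k - j))"
        by simp
    qed simp
    also have "\<dots> = 2 ^ k * pochhammer (real (Suc m) / 2) k"
      by (simp add: add_divide_distrib flip: pochhammer_binomial_sum)
    finally show ?case by (simp add: add.commute)
  qed
  from this[OF order_refl, of k] show ?thesis by (simp add: dot_def power2_eq_square)
qed

section \<open>The mean absolute value of a coordinate\<close>

context invariant_sphere
begin

lemma mean_abs_nonneg: "0 \<le> mean_abs"
  by (simp add: mean_abs_def)

text \<open>
  Integrate \<open>\<bar>x \<bullet> \<theta>\<bar>\<close> over a Gaussian \<open>x\<close> and \<open>\<theta>\<close> distributed by \<open>\<sigma>\<close>. For fixed \<open>\<theta>\<close> the inner product is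
  standard normal with mean absolute value \<open>sqrt (2 / \<pi>)\<close>; for fixed \<open>x\<close> invariance of \<open>\<sigma>\<close> gives \<open>\<bar>x\<bar>\<close>
  times the mean of \<open>\<bar>\<theta> 0\<bar>\<close>.
\<close>

lemma mean_abs_times_gauss_norm:
  "ennreal (sqrt (2 / pi)) = (\<integral>\<^sup>+x. ennreal (sqrt (dot n x x) * mean_abs) \<partial>gauss n)"
proof -
  interpret G: prob_space "gauss n" by (rule prob_space_gauss)
  interpret P: pair_sigma_finite "gauss n" \<sigma> ..
  have "(\<integral>\<^sup>+x. ennreal (sqrt (dot n x x) * mean_abs) \<partial>gauss n)
      = (\<integral>\<^sup>+x. (\<integral>\<^sup>+\<theta>. ennreal \<bar>dot n x \<theta>\<bar> \<partial>\<sigma>) \<partial>gauss n)"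
  proof (rule nn_integral_cong)
    fix x
    show "ennreal (sqrt (dot n x x) * mean_abs) = (\<integral>\<^sup>+\<theta>. ennreal \<bar>dot n x \<theta>\<bar> \<partial>\<sigma>)"
      by (subst nn_integral_eq_integral[OF integrable_abs_dot]) (simp_all add: integral_abs_dot)
  qed
  also have "\<dots> = (\<integral>\<^sup>+\<theta>. (\<integral>\<^sup>+x. ennreal \<bar>dot n x \<theta>\<bar> \<partial>gauss n) \<partial>\<sigma>)"
  proof (rule P.Fubini'[symmetric])
    have c: "(\<lambda>p. fst p i * snd p i) \<in> borel_measurable (gauss n \<Otimes>\<^sub>M \<sigma>)" if "i < n" for i
    proof -
      have "(\<lambda>\<theta>. \<theta> i) \<in> borel_measurable \<sigma>" by (rule measurable_sphere[OF coord_meas[OF that]])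
      with coord_gauss[OF that] show ?thesis by measurable
    qed
    show "(\<lambda>(x, \<theta>). ennreal \<bar>dot n x \<theta>\<bar>) \<in> borel_measurable (gauss n \<Otimes>\<^sub>M \<sigma>)"
      unfolding case_prod_beta dot_def
      by (intro measurable_compose[OF _ measurable_ennreal] borel_measurable_abs borel_measurable_sum c) simp
  qed
  also have "\<dots> = (\<integral>\<^sup>+\<theta>. ennreal (sqrt (2 / pi)) \<partial>\<sigma>)"
  proof (rule nn_integral_cong)
    fix \<theta> assume "\<theta> \<in> space \<sigma>"
    from gauss_abs_dot[OF dot_self_sphere[OF this]]
    show "(\<integral>\<^sup>+x. ennreal \<bar>dot n x \<theta>\<bar> \<partial>gauss n) = ennreal (sqrt (2 / pi))"
      by (subst nn_integral_eq_integral) (simp_all add: has_bochner_integral_iff dot_commute[of n _ \<theta>])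
  qed
  finally show ?thesis by (simp add: emeasure_space_1)
qed

text \<open>
  A lower bound for the mean of \<open>\<bar>\<theta> 0\<bar>\<close> follows from an upper bound for the mean length of a Gaussian
  vector \<open>G\<close>. The latter is \<open>sqrt n\<close> times the mean of \<open>sqrt (\<bar>G\<bar>\<^sup>2 / n)\<close>, where the square root can be
  replaced by its Taylor polynomial since all moments of \<open>\<bar>G\<bar>\<^sup>2\<close> are explicit.
\<close>

lemma mean_abs_lower:
  defines "z \<equiv> 1 / real n"
  shows "sqrt (2 / pi) \<le> mean_abs * sqrt n * (1 - z / 4 + z ^ 2 / 32 + 13 * z ^ 3)"
proof -
  let ?P = "\<lambda>y::real. (63 + 315 * y - 210 * y ^ 2 + 126 * y ^ 3 - 45 * y ^ 4 + 7 * y ^ 5) / 256"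
  let ?y = "\<lambda>x. z * dot n x x"
  have z: "0 < z" "z \<le> 1" "z * n = 1" using n_pos by (auto simp: z_def)
  \<comment> \<open>The \<open>k\<close>-th moment of \<open>\<bar>G\<bar>\<^sup>2 / n\<close>.\<close>
  define m where "m k = (\<Prod>j<k. 1 + 2 * real j * z)" for k
  have mom: "has_bochner_integral (gauss n) (\<lambda>x. ?y x ^ k) (m k)" for k
  proof -
    have "z ^ k * (2 ^ k * pochhammer (n / 2) k) = m k"
    proof (induction k)
      case (Suc k)
      have "z ^ Suc k * (2 ^ Suc k * pochhammer (n / 2) (Suc k))
          = (z ^ k * (2 ^ k * pochhammer (n / 2) k)) * (z * 2 * (n / 2 + k))"
        by (simp add: pochhammer_Suc)
      also have "z * 2 * (n / 2 + k) = 1 + 2 * real k * z" using z(3) by (simp add: algebra_simps)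
      finally show ?case unfolding Suc by (simp add: m_def)
    qed (simp add: m_def)
    moreover have "has_bochner_integral (gauss n) (\<lambda>x. z ^ k * dot n x x ^ k) (z ^ k * (2 ^ k * pochhammer (n / 2) k))"
      by (intro has_bochner_integral_mult_right gauss_norm_moment)
    ultimately show ?thesis by (simp only: power_mult_distrib)
  qed
  interpret G: prob_space "gauss n" by (rule prob_space_gauss)
  have "has_bochner_integral (gauss n) (\<lambda>x. 63 * ?y x ^ 0 + 315 * ?y x ^ 1 - 210 * ?y x ^ 2
      + 126 * ?y x ^ 3 - 45 * ?y x ^ 4 + 7 * ?y x ^ 5)
      (63 * m 0 + 315 * m 1 - 210 * m 2 + 126 * m 3 - 45 * m 4 + 7 * m 5)"
    by (intro has_bochner_integral_add has_bochner_integral_diff has_bochner_integral_mult_right mom)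
  then have "has_bochner_integral (gauss n) (\<lambda>x. mean_abs * sqrt n / 256 * (63 * ?y x ^ 0 + 315 * ?y x ^ 1
      - 210 * ?y x ^ 2 + 126 * ?y x ^ 3 - 45 * ?y x ^ 4 + 7 * ?y x ^ 5))
      (mean_abs * sqrt n / 256 * (63 * m 0 + 315 * m 1 - 210 * m 2 + 126 * m 3 - 45 * m 4 + 7 * m 5))"
    by (intro has_bochner_integral_mult_right)
  then have int: "has_bochner_integral (gauss n) (\<lambda>x. mean_abs * sqrt n * ?P (?y x))
      (mean_abs * sqrt n * ((63 * m 0 + 315 * m 1 - 210 * m 2 + 126 * m 3 - 45 * m 4 + 7 * m 5) / 256))"
    by (simp add: mult_ac)
  have le: "sqrt (dot n x x) * mean_abs \<le> mean_abs * sqrt n * ?P (?y x)" for x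
  proof -
    have "dot n x x = n * ?y x" using z(3) by (simp add: mult_ac)
    then have "sqrt (dot n x x) = sqrt n * sqrt (?y x)" by (metis real_sqrt_mult)
    also have "\<dots> \<le> sqrt n * ?P (?y x)"
      using z(1) dot_nonneg by (intro mult_left_mono sqrt_le_taylor5) auto
    finally have "sqrt (dot n x x) \<le> sqrt n * ?P (?y x)" .
    from mult_right_mono[OF this mean_abs_nonneg] show ?thesis by (simp only: mult_ac)
  qed
  have pos: "0 \<le> mean_abs * sqrt n * ?P (?y x)" for x
    using le[of x] mean_abs_nonneg dot_nonneg[of n x] by (meson mult_nonneg_nonneg order_trans real_sqrt_ge_zero)
  have "ennreal (sqrt (2 / pi)) \<le> (\<integral>\<^sup>+x. ennreal (mean_abs * sqrt n * ?P (?y x)) \<partial>gauss n)"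
    unfolding mean_abs_times_gauss_norm by (intro nn_integral_mono ennreal_leI le)
  also have "\<dots> = ennreal (integral\<^sup>L (gauss n) (\<lambda>x. mean_abs * sqrt n * ?P (?y x)))"
    using int pos by (intro nn_integral_eq_integral) (auto simp: has_bochner_integral_iff)
  finally have "sqrt (2 / pi) \<le> integral\<^sup>L (gauss n) (\<lambda>x. mean_abs * sqrt n * ?P (?y x))"
    using Bochner_Integration.integral_nonneg[of "gauss n" "\<lambda>x. mean_abs * sqrt n * ?P (?y x)", OF pos]
    by (simp only: ennreal_le_iff)
  also have "\<dots> = mean_abs * sqrt n * ((63 * m 0 + 315 * m 1 - 210 * m 2 + 126 * m 3 - 45 * m 4 + 7 * m 5) / 256)"
    using int by (simp only: has_bochner_integral_iff)
  also have "(63 * m 0 + 315 * m 1 - 210 * m 2 + 126 * m 3 - 45 * m 4 + 7 * m 5) / 256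
      = 1 - z / 4 + z ^ 2 / 32 + 5 / 2 * z ^ 3 + 21 / 2 * z ^ 4"
    by (simp add: m_def eval_nat_numeral field_simps)
  also have "mean_abs * sqrt n * \<dots> \<le> mean_abs * sqrt n * (1 - z / 4 + z ^ 2 / 32 + 13 * z ^ 3)"
  proof -
    have "z ^ 4 \<le> z ^ 3" using z by (intro power_decreasing) auto
    then show ?thesis using mean_abs_nonneg by (intro mult_left_mono) auto
  qed
  finally show ?thesis .
qed

text \<open>
  Here \<open>1 - d\<close> is the upper bound for the mean of \<open>\<bar>G\<bar> / sqrt n\<close> found above.
\<close>

lemma mean_abs_square_lower:
  defines "z \<equiv> 1 / real n"
  defines "d \<equiv> z / 4 - z ^ 2 / 32 - 13 * z ^ 3"
  shows "2 / pi * (1 + 2 * d + 3 * d\<^sup>2 + 4 * d ^ 3) \<le> n * mean_abs\<^sup>2"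
proof -
  have z: "0 < z" "z \<le> 1" using n_pos by (auto simp: z_def)
  have d: "d < 1"
  proof -
    have "0 \<le> z ^ 2" "0 \<le> z ^ 3" using z by simp_all
    then show ?thesis using z unfolding d_def by linarith
  qed
  have "sqrt (2 / pi) \<le> mean_abs * sqrt n * (1 - d)"
    using mean_abs_lower unfolding d_def z_def by (simp add: algebra_simps)
  then have "(sqrt (2 / pi))\<^sup>2 \<le> (mean_abs * sqrt n * (1 - d))\<^sup>2"
    by (intro power_mono) auto
  then have "2 / pi \<le> n * mean_abs\<^sup>2 * (1 - d)\<^sup>2"
    by (simp add: power_mult_distrib mult_ac)
  then have "2 / pi * (1 / (1 - d)\<^sup>2) \<le> n * mean_abs\<^sup>2"
    using d by (simp add: pos_divide_le_eq mult_ac)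
  moreover have "2 / pi * (1 + 2 * d + 3 * d\<^sup>2 + 4 * d ^ 3) \<le> 2 / pi * (1 / (1 - d)\<^sup>2)"
    by (intro mult_left_mono inverse_square_ge d) simp
  ultimately show ?thesis by linarith
qed

end

section \<open>The second moment of two projections\<close>

text \<open>
  The vector \<open>(a\<^sup>2 - b\<^sup>2, 2 a b)\<close> has length \<open>a\<^sup>2 + b\<^sup>2\<close>. In polar coordinates the trigonometric
  polynomial is therefore this length times a shifted cosine, and the shift disappears when one integrates over
  a period.
\<close>

lemma rotation_average:
  fixes a b \<rho> :: real
  assumes \<rho>: "\<bar>\<rho>\<bar> \<le> 1"
  shows "(\<integral>\<^sup>+t. indicator {0..2 * pi} t * ennreal \<bar>\<rho> * (a\<^sup>2 + b\<^sup>2) + ((a\<^sup>2 - b\<^sup>2) * cos t + 2 * a * b * sin t)\<bar> \<partial>lborel)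
    = ennreal (4 * arcsine_kernel \<rho> * (a\<^sup>2 + b\<^sup>2))"
proof -
  define r where "r = a\<^sup>2 + b\<^sup>2"
  have r: "0 \<le> r" by (simp add: r_def)
  obtain c where c: "0 \<le> c" "c \<le> 2 * pi" "a\<^sup>2 - b\<^sup>2 = r * cos c" "2 * a * b = r * sin c"
  proof (cases "r = 0")
    case True
    then have "a = 0" "b = 0" by (auto simp: r_def add_nonneg_eq_0_iff)
    then show ?thesis using that[of 0] by (simp add: r_def)
  next
    case False
    have "(a\<^sup>2 - b\<^sup>2)\<^sup>2 + (2 * a * b)\<^sup>2 = r\<^sup>2" unfolding r_def by algebra
    then have "((a\<^sup>2 - b\<^sup>2) / r)\<^sup>2 + (2 * a * b / r)\<^sup>2 = 1"
      using False by (simp add: power_divide flip: add_divide_distrib)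
    then obtain t where "0 \<le> t" "t < 2 * pi" "(a\<^sup>2 - b\<^sup>2) / r = cos t" "2 * a * b / r = sin t"
      by (rule sincos_total_2pi)
    then show ?thesis using that[of t] False by (simp add: field_simps)
  qed
  have eq: "\<rho> * r + ((a\<^sup>2 - b\<^sup>2) * cos t + 2 * a * b * sin t) = r * (\<rho> + cos (t - c))" for t
    unfolding c(3,4) by (simp add: cos_diff algebra_simps)
  let ?f = "\<lambda>t. r * \<bar>\<rho> + cos (t - c)\<bar>"
  have "integral {0..2 * pi} (\<lambda>t. \<bar>\<rho> + cos (t - c)\<bar>) = 4 * arcsine_kernel \<rho>"
    using integral_periodic_shift[of "\<lambda>t. \<bar>\<rho> + cos t\<bar>" "2 * pi" c] c(1,2) integral_abs_add_cos[OF \<rho>]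
    by (simp add: continuous_intros)
  moreover have "(\<lambda>t. \<bar>\<rho> + cos (t - c)\<bar>) integrable_on {0..2 * pi}"
    by (intro integrable_continuous_interval continuous_intros)
  ultimately have "(?f has_integral r * (4 * arcsine_kernel \<rho>)) {0..2 * pi}"
    by (metis has_integral_mult_right integrable_integral)
  then have "(\<integral>\<^sup>+t. indicator {0..2 * pi} t * ennreal (?f t) \<partial>lborel) = ennreal (r * (4 * arcsine_kernel \<rho>))"
    using nn_integral_has_integral_lebesgue[of "{0..2 * pi}" ?f] r
    by (simp add: ennreal_mult' ennreal_indicator)
  moreover have "\<bar>\<rho> * (a\<^sup>2 + b\<^sup>2) + ((a\<^sup>2 - b\<^sup>2) * cos t + 2 * a * b * sin t)\<bar> = ?f t" for t
    unfolding r_def[symmetric] eq using r by (simp add: abs_mult)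
  ultimately show ?thesis by (simp add: r_def mult_ac)
qed

context invariant_sphere
begin

text \<open>
  Let \<open>a = p \<bullet> \<theta>\<close> and \<open>b = q \<bullet> \<theta>\<close>. The law of the projection of \<open>\<theta>\<close> to a plane is invariant under the orthogonal group of the plane.
  Hence the integral does not change when the integrand is first averaged over the reflections in
  \<open>w = cos (t / 4) p + sin (t / 4) q\<close>, which leave \<open>a\<^sup>2 + b\<^sup>2\<close> fixed and rotate \<open>(a\<^sup>2 - b\<^sup>2, 2 a b)\<close> by the
  angle \<open>t\<close> up to orientation. After averaging only \<open>a\<^sup>2 + b\<^sup>2\<close> remains, with integral \<open>2 / n\<close>.
\<close>

lemma integral_orthonormal_pair:
  assumes \<rho>: "\<bar>\<rho>\<bar> \<le> 1" and p: "dot n p p = 1" and q: "dot n q q = 1" and pq: "dot n p q = 0"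
  shows "(\<integral>\<theta>. \<bar>\<rho> * ((dot n p \<theta>)\<^sup>2 + (dot n q \<theta>)\<^sup>2) + ((dot n p \<theta>)\<^sup>2 - (dot n q \<theta>)\<^sup>2)\<bar> \<partial>\<sigma>)
    = 4 / (pi * n) * arcsine_kernel \<rho>"
proof -
  let ?a = "dot n p" and ?b = "dot n q"
  let ?f = "\<lambda>t \<theta>. \<bar>\<rho> * ((?a \<theta>)\<^sup>2 + (?b \<theta>)\<^sup>2) + (((?a \<theta>)\<^sup>2 - (?b \<theta>)\<^sup>2) * cos t + 2 * ?a \<theta> * ?b \<theta> * sin t)\<bar>"
  define K where "K = (\<integral>\<theta>. ?f 0 \<theta> \<partial>\<sigma>)"
  have int: "integrable \<sigma> (?f t)" for t
  proof -
    have "continuous_on UNIV (\<lambda>z::real \<times> real. \<bar>\<rho> * ((fst z)\<^sup>2 + (snd z)\<^sup>2)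
        + (((fst z)\<^sup>2 - (snd z)\<^sup>2) * cos t + 2 * fst z * snd z * sin t)\<bar>)"
      by (intro continuous_intros)
    from integrable_continuous_dot2[OF this, of p q] show ?thesis by simp
  qed
  have const: "(\<integral>\<theta>. ?f t \<theta> \<partial>\<sigma>) = K" for t
  proof -
    define c s where "c = cos (t / 4)" and "s = sin (t / 4)"
    define w where "w = (\<lambda>i. c * p i + s * q i)"
    have cs: "c\<^sup>2 + s\<^sup>2 = 1" by (simp add: c_def s_def)
    have dw: "dot n w z = c * dot n p z + s * dot n q z" for z
      by (simp add: w_def dot_add dot_scale)
    have pw: "dot n p w = c" "dot n q w = s"
      using p q pq by (simp_all add: dot_commute[of n _ w] dw dot_commute[of n q p])
    have ww: "dot n w w = 1" using cs by (simp add: dw pw power2_eq_square)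
    have half: "cos (t / 2) = c\<^sup>2 - s\<^sup>2" "sin (t / 2) = 2 * s * c"
      using cos_double[of "t / 4"] sin_double[of "t / 4"] by (simp_all add: c_def s_def)
    have full: "cos t = (c\<^sup>2 - s\<^sup>2)\<^sup>2 - (2 * s * c)\<^sup>2" "sin t = 2 * (2 * s * c) * (c\<^sup>2 - s\<^sup>2)"
      using cos_double[of "t / 2"] sin_double[of "t / 2"] unfolding half by simp_all
    have "?f 0 (mat_app n (reflection w) \<theta>) = ?f t \<theta>" for \<theta>
    proof -
      let ?u = "c * ?a \<theta> + s * ?b \<theta>"
      have A: "?a (mat_app n (reflection w) \<theta>) = ?a \<theta> - 2 * c * ?u"
        and B: "?b (mat_app n (reflection w) \<theta>) = ?b \<theta> - 2 * s * ?u"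
        by (simp_all add: dot_reflection pw dw)
      have sum: "(?a \<theta> - 2 * c * ?u)\<^sup>2 + (?b \<theta> - 2 * s * ?u)\<^sup>2 = (?a \<theta>)\<^sup>2 + (?b \<theta>)\<^sup>2"
        using cs by algebra
      have diff: "(?a \<theta> - 2 * c * ?u)\<^sup>2 - (?b \<theta> - 2 * s * ?u)\<^sup>2
          = ((?a \<theta>)\<^sup>2 - (?b \<theta>)\<^sup>2) * cos t + 2 * ?a \<theta> * ?b \<theta> * sin t"
        unfolding full using cs by algebra
      show ?thesis unfolding A B sum using diff by simp
    qed
    then show ?thesis
      using integral_reflection[OF ww borel_measurable_integrable[OF int[of 0]]] by (simp add: K_def)
  qed
  have K0: "0 \<le> K" by (simp add: K_def)
  have ak: "0 \<le> arcsine_kernel \<rho>"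
  proof -
    have "0 \<le> integral {0..2 * pi} (\<lambda>t. \<bar>\<rho> + cos t\<bar>)"
      by (rule Henstock_Kurzweil_Integration.integral_nonneg)
        (auto intro!: integrable_continuous_interval continuous_intros)
    then show ?thesis using integral_abs_add_cos[OF \<rho>] by simp
  qed
  interpret P: pair_sigma_finite \<sigma> "lborel :: real measure" ..
  have "ennreal (2 * pi * K) = (\<integral>\<^sup>+t. indicator {0..2 * pi} t * ennreal K \<partial>lborel)"
    using K0 by (subst nn_integral_multc) (simp_all add: ennreal_mult)
  also have "\<dots> = (\<integral>\<^sup>+t. (\<integral>\<^sup>+\<theta>. indicator {0..2 * pi} t * ennreal (?f t \<theta>) \<partial>\<sigma>) \<partial>lborel)"
  proof (rule nn_integral_cong)
    fix t :: real
    have "(\<integral>\<^sup>+\<theta>. ennreal (?f t \<theta>) \<partial>\<sigma>) = ennreal K"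
      by (subst nn_integral_eq_integral[OF int]) (simp_all only: const, simp)
    then show "indicator {0..2 * pi} t * ennreal K = (\<integral>\<^sup>+\<theta>. indicator {0..2 * pi} t * ennreal (?f t \<theta>) \<partial>\<sigma>)"
      by (subst nn_integral_cmult) simp_all
  qed
  also have "\<dots> = (\<integral>\<^sup>+\<theta>. (\<integral>\<^sup>+t. indicator {0..2 * pi} t * ennreal (?f t \<theta>) \<partial>lborel) \<partial>\<sigma>)"
    by (rule P.Fubini') measurable
  also have "\<dots> = (\<integral>\<^sup>+\<theta>. ennreal (4 * arcsine_kernel \<rho> * ((?a \<theta>)\<^sup>2 + (?b \<theta>)\<^sup>2)) \<partial>\<sigma>)"
    by (simp only: rotation_average[OF \<rho>])
  also have "\<dots> = ennreal (\<integral>\<theta>. 4 * arcsine_kernel \<rho> * ((?a \<theta>)\<^sup>2 + (?b \<theta>)\<^sup>2) \<partial>\<sigma>)"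
  proof (rule nn_integral_eq_integral)
    have "continuous_on UNIV (\<lambda>z::real \<times> real. 4 * arcsine_kernel \<rho> * ((fst z)\<^sup>2 + (snd z)\<^sup>2))"
      by (intro continuous_intros)
    from integrable_continuous_dot2[OF this, of p q]
    show "integrable \<sigma> (\<lambda>\<theta>. 4 * arcsine_kernel \<rho> * ((?a \<theta>)\<^sup>2 + (?b \<theta>)\<^sup>2))" by simp
  qed (use ak in simp)
  also have "(\<integral>\<theta>. 4 * arcsine_kernel \<rho> * ((?a \<theta>)\<^sup>2 + (?b \<theta>)\<^sup>2) \<partial>\<sigma>) = 4 * arcsine_kernel \<rho> * (2 / n)"
    by (simp add: integrable_dot_square integral_dot_square p q)
  finally have "2 * pi * K = 4 * arcsine_kernel \<rho> * (2 / n)"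
    using K0 ak by (subst (asm) ennreal_inj) auto
  then have "K = 4 / (pi * n) * arcsine_kernel \<rho>" using n_pos by (simp add: field_simps)
  then show ?thesis by (simp add: K_def)
qed

text \<open>
  The vectors \<open>x + y\<close> and \<open>x - y\<close> are orthogonal because \<open>x\<close> and \<open>y\<close> have the same length. By
  polarisation \<open>(x \<bullet> \<theta>) (y \<bullet> \<theta>)\<close> is a difference of squares in the normalised directions.
\<close>

lemma integral_abs_dot_product:
  assumes x: "dot n x x = n" and y: "dot n y y = n" and \<rho>: "\<bar>dot n x y / n\<bar> < 1"
  shows "(\<integral>\<theta>. \<bar>dot n x \<theta>\<bar> * \<bar>dot n y \<theta>\<bar> \<partial>\<sigma>) = 2 / pi * arcsine_kernel (dot n x y / n)"
proof -
  define \<rho> where "\<rho> = dot n x y / n"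
  have n0: "0 < real n" using n_pos by simp
  have \<rho>1: "0 < 1 + \<rho>" "0 < 1 - \<rho>" and xy: "dot n x y = n * \<rho>"
    using assms(3) n0 by (auto simp: \<rho>_def[symmetric] abs_less_iff) (simp add: \<rho>_def)
  define u v where "u = inverse (sqrt (2 * n * (1 + \<rho>)))" and "v = inverse (sqrt (2 * n * (1 - \<rho>)))"
  have u2: "u\<^sup>2 * (2 * n * (1 + \<rho>)) = 1" and v2: "v\<^sup>2 * (2 * n * (1 - \<rho>)) = 1"
  proof -
    have inv: "(inverse (sqrt s))\<^sup>2 * s = 1" if "0 < s" for s :: real
      using that by (simp add: power_inverse)
    show "u\<^sup>2 * (2 * n * (1 + \<rho>)) = 1" "v\<^sup>2 * (2 * n * (1 - \<rho>)) = 1"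
      unfolding u_def v_def using \<rho>1 n0 by (intro inv mult_pos_pos; simp)+
  qed
  define p q where "p = (\<lambda>i. u * (x i + y i))" and "q = (\<lambda>i. v * (x i - y i))"
  have dp: "dot n p z = u * (dot n x z + dot n y z)" and dq: "dot n q z = v * (dot n x z - dot n y z)" for z
    by (simp_all add: p_def q_def dot_scale dot_add dot_diff)
  have x': "dot n x p = u * (n + n * \<rho>)" "dot n y p = u * (n + n * \<rho>)"
    "dot n x q = v * (n - n * \<rho>)" "dot n y q = v * (n * \<rho> - n)"
    using x y xy by (simp_all add: dot_commute[of n _ p] dot_commute[of n _ q] dp dq dot_commute[of n y x])
  have pp: "dot n p p = 1" and qq: "dot n q q = 1" and pq: "dot n p q = 0"
    using u2 v2 by (simp_all add: dp dq x' power2_eq_square algebra_simps)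
  have "\<bar>dot n x \<theta>\<bar> * \<bar>dot n y \<theta>\<bar>
      = n / 2 * \<bar>\<rho> * ((dot n p \<theta>)\<^sup>2 + (dot n q \<theta>)\<^sup>2) + ((dot n p \<theta>)\<^sup>2 - (dot n q \<theta>)\<^sup>2)\<bar>" for \<theta>
  proof -
    let ?s = "dot n x \<theta>" and ?t = "dot n y \<theta>"
    have "4 * (n / 2 * (\<rho> * ((dot n p \<theta>)\<^sup>2 + (dot n q \<theta>)\<^sup>2) + ((dot n p \<theta>)\<^sup>2 - (dot n q \<theta>)\<^sup>2)))
        = (u\<^sup>2 * (2 * n * (1 + \<rho>))) * (?s + ?t)\<^sup>2 - (v\<^sup>2 * (2 * n * (1 - \<rho>))) * (?s - ?t)\<^sup>2"
      unfolding dp dq by (simp add: power2_eq_square algebra_simps)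
    also have "\<dots> = 4 * (?s * ?t)"
      unfolding u2 v2 by (simp add: power2_eq_square algebra_simps)
    finally have "?s * ?t = n / 2 * (\<rho> * ((dot n p \<theta>)\<^sup>2 + (dot n q \<theta>)\<^sup>2) + ((dot n p \<theta>)\<^sup>2 - (dot n q \<theta>)\<^sup>2))"
      by simp
    then have "\<bar>?s * ?t\<bar> = \<bar>n / 2\<bar> * \<bar>\<rho> * ((dot n p \<theta>)\<^sup>2 + (dot n q \<theta>)\<^sup>2) + ((dot n p \<theta>)\<^sup>2 - (dot n q \<theta>)\<^sup>2)\<bar>"
      by (simp only: abs_mult)
    then show ?thesis by (simp only: abs_mult)
  qed
  moreover have "\<bar>\<rho>\<bar> \<le> 1" using \<rho>1 by (simp add: abs_le_iff)
  ultimately have "(\<integral>\<theta>. \<bar>dot n x \<theta>\<bar> * \<bar>dot n y \<theta>\<bar> \<partial>\<sigma>) = n / 2 * (4 / (pi * n) * arcsine_kernel \<rho>)"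
    by (simp only: integral_mult_right_zero integral_orthonormal_pair[OF _ pp qq pq])
  then show ?thesis using n0 by (simp add: \<rho>_def)
qed

text \<open>
  Where \<open>\<bar>\<rho>\<bar>\<close> exceeds \<open>1 / 2\<close> the term of degree 6 dominates the trivial bound 1; its coefficient 64
  is chosen for that. This also covers the degenerate pairs \<open>y = x\<close> and \<open>y = -x\<close>.
\<close>

lemma integral_abs_dot_product_le:
  assumes x: "dot n x x = n" and y: "dot n y y = n"
  defines "\<rho> \<equiv> dot n x y / n"
  shows "(\<integral>\<theta>. \<bar>dot n x \<theta>\<bar> * \<bar>dot n y \<theta>\<bar> \<partial>\<sigma>) \<le> 2 / pi * (1 + \<rho>\<^sup>2 / 2 + \<rho> ^ 4 / 24 + 64 * \<rho> ^ 6)"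
proof (cases "\<bar>\<rho>\<bar> \<le> 1 / 2")
  case True
  then have "(\<integral>\<theta>. \<bar>dot n x \<theta>\<bar> * \<bar>dot n y \<theta>\<bar> \<partial>\<sigma>) = 2 / pi * arcsine_kernel \<rho>"
    unfolding \<rho>_def using integral_abs_dot_product[OF x y] by linarith
  also have "\<dots> \<le> 2 / pi * (1 + \<rho>\<^sup>2 / 2 + \<rho> ^ 4 / 24 + \<rho> ^ 6)"
    by (intro mult_left_mono arcsine_kernel_le True) simp
  also have "\<dots> \<le> 2 / pi * (1 + \<rho>\<^sup>2 / 2 + \<rho> ^ 4 / 24 + 64 * \<rho> ^ 6)"
    by (intro mult_left_mono) auto
  finally show ?thesis .
next
  case False
  have "(\<integral>\<theta>. \<bar>dot n x \<theta>\<bar> * \<bar>dot n y \<theta>\<bar> \<partial>\<sigma>) \<le> (\<integral>\<theta>. ((dot n x \<theta>)\<^sup>2 + (dot n y \<theta>)\<^sup>2) / 2 \<partial>\<sigma>)"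
  proof (rule integral_mono[OF integrable_abs_dot_mult])
    show "integrable \<sigma> (\<lambda>\<theta>. ((dot n x \<theta>)\<^sup>2 + (dot n y \<theta>)\<^sup>2) / 2)"
      by (simp add: integrable_dot_square)
    fix \<theta>
    have "0 \<le> (\<bar>dot n x \<theta>\<bar> - \<bar>dot n y \<theta>\<bar>)\<^sup>2" by simp
    then show "\<bar>dot n x \<theta>\<bar> * \<bar>dot n y \<theta>\<bar> \<le> ((dot n x \<theta>)\<^sup>2 + (dot n y \<theta>)\<^sup>2) / 2"
      by (simp add: power2_diff)
  qed
  also have "\<dots> = 1" using n_pos by (simp add: integrable_dot_square integral_dot_square x y)
  also have "1 \<le> 2 / pi * 2" using pi_less_4 by (simp add: field_simps)
  also have "\<dots> \<le> 2 / pi * (1 + \<rho>\<^sup>2 / 2 + \<rho> ^ 4 / 24 + 64 * \<rho> ^ 6)"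
  proof (rule mult_left_mono)
    have "(1 / 2) ^ 6 \<le> \<bar>\<rho>\<bar> ^ 6" using False by (intro power_mono) auto
    then have "1 \<le> 64 * \<rho> ^ 6" by (simp add: power_even_abs power_divide)
    moreover have "0 \<le> \<rho>\<^sup>2 / 2" "0 \<le> \<rho> ^ 4 / 24" by simp_all
    ultimately show "2 \<le> 1 + \<rho>\<^sup>2 / 2 + \<rho> ^ 4 / 24 + 64 * \<rho> ^ 6" by linarith
  qed simp
  finally show ?thesis .
qed

end

section \<open>Sums over the cube\<close>

text \<open>
  The last coordinate takes each of its two values once, which makes sums over the cube of functions
  of \<open>c \<bullet> x\<close> accessible to induction on the dimension.
\<close>

lemma sum_cube_Suc:
  "(\<Sum>x\<in>cube (Suc n). g (dot (Suc n) c x)) = (\<Sum>x\<in>cube n. g (dot n c x + c n) + g (dot n c x - c n))"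
proof -
  let ?f = "\<lambda>(e, x). x(n := e)"
  have cube: "cube (Suc n) = ?f ` ({-1, 1} \<times> cube n)"
    unfolding cube_def lessThan_Suc by (rule PiE_insert_eq)
  have inj: "inj_on ?f ({-1, 1} \<times> cube n)"
    unfolding cube_def by (rule inj_combinator) simp
  have upd: "dot (Suc n) c (x(n := e)) = dot n c x + c n * e" for x e
    by (simp add: dot_def)
  have "(\<Sum>x\<in>cube (Suc n). g (dot (Suc n) c x)) = (\<Sum>e\<in>{-1, 1}. \<Sum>x\<in>cube n. g (dot n c x + c n * e))"
    unfolding cube sum.reindex[OF inj] sum.cartesian_product
    by (intro sum.cong refl) (auto simp: upd)
  then show ?thesis by (simp add: sum.distrib add.commute)
qed

lemma card_cube: "card (cube n) = 2 ^ n"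
  by (simp add: cube_def card_PiE numeral_2_eq_2)

lemma finite_cube: "finite (cube n)"
  unfolding cube_def by (intro finite_PiE) auto

lemma cube_0: "cube 0 = {\<lambda>_. undefined}"
  by (simp add: cube_def)

lemma cube_sign: "x \<in> cube n \<Longrightarrow> i < n \<Longrightarrow> x i = 1 \<or> x i = -1"
  by (auto simp: cube_def PiE_iff)

lemma dot_self_cube: "x \<in> cube n \<Longrightarrow> dot n x x = n"
proof -
  assume "x \<in> cube n"
  from cube_sign[OF this] have "x i * x i = 1" if "i < n" for i using that by fastforce
  then show ?thesis by (simp add: dot_def)
qed

lemma sum_dot_cube: "(\<Sum>x\<in>cube n. dot n c x) = 0"
proof (induction n)
  case (Suc n)
  have "(\<Sum>x\<in>cube (Suc n). dot (Suc n) c x) = (\<Sum>x\<in>cube n. 2 * dot n c x)"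
    using sum_cube_Suc[where g = "\<lambda>t. t"] by simp
  then show ?case using Suc by (simp flip: sum_distrib_left)
qed (simp add: cube_0 dot_def)

lemma sum_cube_Suc_sign:
  assumes "c n = 1 \<or> c n = (-1::real)"
  shows "(\<Sum>x\<in>cube (Suc n). g (dot (Suc n) c x)) = (\<Sum>x\<in>cube n. g (dot n c x + 1) + g (dot n c x - 1) :: real)"
  unfolding sum_cube_Suc using assms by (auto intro!: sum.cong)

text \<open>
  The recursion for the moments of a simple random walk: expand \<open>(t + 1) ^ k + (t - 1) ^ k\<close>. The
  second and fourth moment enter the final cancellation and must be exact, whereas the sixth belongs to the error.
\<close>

lemma cube_moments:
  assumes "\<And>i. i < n \<Longrightarrow> c i = 1 \<or> c i = (-1::real)"
  shows "(\<Sum>x\<in>cube n. dot n c x ^ 2) = 2 ^ n * n"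
    and "(\<Sum>x\<in>cube n. dot n c x ^ 4) = 2 ^ n * (3 * real n ^ 2 - 2 * n)"
    and "(\<Sum>x\<in>cube n. dot n c x ^ 6) \<le> 2 ^ n * (15 * real n ^ 3)"
proof -
  have "(\<Sum>x\<in>cube n. dot n c x ^ 2) = 2 ^ n * n \<and>
    (\<Sum>x\<in>cube n. dot n c x ^ 4) = 2 ^ n * (3 * real n ^ 2 - 2 * n) \<and>
    (\<Sum>x\<in>cube n. dot n c x ^ 6) \<le> 2 ^ n * (15 * real n ^ 3)"
    using assms
  proof (induction n)
    case (Suc n)
    let ?S = "\<lambda>k. \<Sum>x\<in>cube n. dot n c x ^ k"
    have IH: "?S 2 = 2 ^ n * n" "?S 4 = 2 ^ n * (3 * real n ^ 2 - 2 * n)" "?S 6 \<le> 2 ^ n * (15 * real n ^ 3)"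
      using Suc by auto
    have c: "c n = 1 \<or> c n = -1" using Suc.prems by simp
    have e2: "(t + 1) ^ 2 + (t - 1) ^ 2 = 2 * t ^ 2 + 2" for t :: real by algebra
    have e4: "(t + 1) ^ 4 + (t - 1) ^ 4 = 2 * t ^ 4 + 12 * t ^ 2 + 2" for t :: real by algebra
    have e6: "(t + 1) ^ 6 + (t - 1) ^ 6 = 2 * t ^ 6 + 30 * t ^ 4 + 30 * t ^ 2 + 2" for t :: real by algebra
    have "(\<Sum>x\<in>cube (Suc n). dot (Suc n) c x ^ 2) = 2 * ?S 2 + 2 * 2 ^ n"
      unfolding sum_cube_Suc_sign[of c, OF c, where g = "\<lambda>t. t ^ 2"] e2
      by (simp add: sum.distrib card_cube flip: sum_distrib_left)
    moreover have "(\<Sum>x\<in>cube (Suc n). dot (Suc n) c x ^ 4) = 2 * ?S 4 + 12 * ?S 2 + 2 * 2 ^ n"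
      unfolding sum_cube_Suc_sign[of c, OF c, where g = "\<lambda>t. t ^ 4"] e4
      by (simp add: sum.distrib card_cube flip: sum_distrib_left)
    moreover have "(\<Sum>x\<in>cube (Suc n). dot (Suc n) c x ^ 6) \<le> 2 ^ Suc n * (15 * real (Suc n) ^ 3)"
    proof -
      have "(\<Sum>x\<in>cube (Suc n). dot (Suc n) c x ^ 6) = 2 * ?S 6 + 30 * ?S 4 + 30 * ?S 2 + 2 * 2 ^ n"
        unfolding sum_cube_Suc_sign[of c, OF c, where g = "\<lambda>t. t ^ 6"] e6
        by (simp add: sum.distrib card_cube flip: sum_distrib_left)
      also have "\<dots> \<le> 2 * (2 ^ n * (15 * real n ^ 3)) + 30 * (2 ^ n * (3 * real n ^ 2 - 2 * n)) + 30 * (2 ^ n * n) + 2 * 2 ^ n"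
        using IH by simp
      also have "\<dots> = 2 ^ Suc n * (15 * real n ^ 3 + 45 * real n ^ 2 - 15 * n + 1)"
        by (simp add: algebra_simps)
      also have "\<dots> \<le> 2 ^ Suc n * (15 * real (Suc n) ^ 3)"
        by (intro mult_left_mono) (simp_all add: algebra_simps power2_eq_square power3_eq_cube)
      finally show ?thesis .
    qed
    ultimately show ?case using IH by (simp add: algebra_simps power2_eq_square)
  qed (simp add: cube_0 dot_def)
  then show "(\<Sum>x\<in>cube n. dot n c x ^ 2) = 2 ^ n * n"
    and "(\<Sum>x\<in>cube n. dot n c x ^ 4) = 2 ^ n * (3 * real n ^ 2 - 2 * n)"
    and "(\<Sum>x\<in>cube n. dot n c x ^ 6) \<le> 2 ^ n * (15 * real n ^ 3)" by auto
qed

text \<open>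
  Since \<open>max t 0 = (\<bar>t\<bar> + t) / 2\<close> and the linear part cancels over the cube, \<open>F\<close> is half the mean of \<open>\<bar>x \<bullet> \<theta>\<bar>\<close>.
\<close>

lemma F_fun_cube: "F_fun n (cube_measure n) \<theta> = (\<Sum>x\<in>cube n. \<bar>dot n x \<theta>\<bar>) / 2 ^ Suc n"
proof -
  have m: "(\<lambda>x. x) \<in> uniform_count_measure (cube n) \<rightarrow>\<^sub>M borel_vec n"
    by (auto simp: measurable_def space_uniform_count_measure sets_uniform_count_measure
        space_borel_vec cube_def)
  have meas: "(\<lambda>x. max (dot n x \<theta>) 0) \<in> borel_measurable (borel_vec n)"
    using dot_meas[of n \<theta>] by (simp add: dot_commute[of n _ \<theta>])
  have "F_fun n (cube_measure n) \<theta> = (\<integral>x. max (dot n x \<theta>) 0 \<partial>uniform_count_measure (cube n))"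
    unfolding F_fun_def cube_measure_def by (rule integral_distr[OF m meas])
  also have "\<dots> = (\<Sum>x\<in>cube n. max (dot n x \<theta>) 0) / 2 ^ n"
    by (simp add: integral_uniform_count_measure finite_cube card_cube)
  also have "(\<Sum>x\<in>cube n. max (dot n x \<theta>) 0) = (\<Sum>x\<in>cube n. (\<bar>dot n x \<theta>\<bar> + dot n \<theta> x) / 2)"
    by (intro sum.cong refl) (simp add: dot_commute[of n \<theta>] max_def)
  also have "\<dots> = (\<Sum>x\<in>cube n. \<bar>dot n x \<theta>\<bar>) / 2"
    by (simp add: sum_dot_cube sum.distrib flip: sum_divide_distrib)
  finally show ?thesis by simp
qed

section \<open>The variance\<close>

text \<open>
  With \<open>z = 1 / n\<close> the terms on the left of order 1 and 2 are those of the second moment of \<open>F\<close>, the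
  right-hand side is the corresponding expression for the squared mean. That they agree is the reason for the
  rate \<open>z ^ 3\<close>. The constant is a crude bound for the remaining terms.
\<close>

lemma deficit_expansion:
  fixes z :: real
  assumes "0 \<le> z" "z \<le> 1"
  defines "d \<equiv> z / 4 - z ^ 2 / 32 - 13 * z ^ 3"
  shows "z / 2 + z\<^sup>2 / 8 - 12000 * z ^ 3 \<le> 2 * d + 3 * d\<^sup>2 + 4 * d ^ 3"
proof -
  define e where "e = 1 / 4 - z / 32 - 13 * z ^ 2"
  have d: "d = z * e" by (simp add: d_def e_def algebra_simps power2_eq_square power3_eq_cube)
  have z2: "0 \<le> z ^ 2" "z ^ 2 \<le> z" using assms by (auto simp: power2_eq_square mult_left_le)
  have e: "1 / 4 - 14 * z \<le> e" using z2 assms(1) by (simp add: e_def)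
  have "1 / 16 - 7 * z \<le> e\<^sup>2"
  proof -
    have "0 \<le> (e - 1 / 4)\<^sup>2" by simp
    then show ?thesis using e by (simp add: power2_eq_square algebra_simps)
  qed
  then have "z\<^sup>2 * (1 / 16 - 7 * z) \<le> z\<^sup>2 * e\<^sup>2" by (intro mult_left_mono) auto
  then have 2: "z\<^sup>2 / 16 - 7 * z ^ 3 \<le> d\<^sup>2"
    by (simp add: d power_mult_distrib algebra_simps power2_eq_square power3_eq_cube)
  have "(-14) ^ 3 \<le> e ^ 3" using e assms(2) by (intro power_mono_odd) auto
  then have "z ^ 3 * (-14) ^ 3 \<le> z ^ 3 * e ^ 3" using assms(1) by (intro mult_left_mono) auto
  then have 3: "- 2744 * z ^ 3 \<le> d ^ 3" by (simp add: d power_mult_distrib)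
  have "2 * d = z / 2 - z\<^sup>2 / 16 - 26 * z ^ 3" by (simp add: d_def)
  moreover have "0 \<le> z ^ 3" using assms(1) by simp
  ultimately show ?thesis using 2 3 by linarith
qed

context invariant_sphere
begin

text \<open>
  Expanding the square gives the average over pairs \<open>(x, y)\<close> of vertices of the integral of
  \<open>\<bar>x \<bullet> \<theta>\<bar> \<bar>y \<bullet> \<theta>\<bar>\<close>. For fixed \<open>x\<close> the correlation \<open>\<rho> = x \<bullet> y / n\<close> is a normalised random walk, with
  \<open>E \<rho>\<^sup>2 = z\<close> and \<open>E \<rho>\<^sup>4 = 3 z\<^sup>2 - 2 z\<^sup>3\<close>; this turns \<open>\<rho>\<^sup>2 / 2 + \<rho>\<^sup>4 / 24\<close> into \<open>z / 2 + z\<^sup>2 / 8\<close>.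
\<close>

lemma second_moment_F:
  defines "z \<equiv> 1 / real n"
  shows "integrable \<sigma> (\<lambda>\<theta>. (F_fun n (cube_measure n) \<theta>)\<^sup>2)"
    and "(\<integral>\<theta>. (F_fun n (cube_measure n) \<theta>)\<^sup>2 \<partial>\<sigma>) \<le> 1 / (2 * pi) * (1 + z / 2 + z\<^sup>2 / 8 + 960 * z ^ 3)"
proof -
  have z: "0 < z" using n_pos by (simp add: z_def)
  let ?g = "\<lambda>x y \<theta>. \<bar>dot n x \<theta>\<bar> * \<bar>dot n y \<theta>\<bar>"
  have F: "(F_fun n (cube_measure n) \<theta>)\<^sup>2 = (\<Sum>x\<in>cube n. \<Sum>y\<in>cube n. ?g x y \<theta>) / (2 ^ Suc n)\<^sup>2" for \<theta>
    unfolding F_fun_cube power_divide by (simp add: power2_eq_square[of "sum _ _"] sum_product)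
  show "integrable \<sigma> (\<lambda>\<theta>. (F_fun n (cube_measure n) \<theta>)\<^sup>2)"
    unfolding F by (intro integrable_divide Bochner_Integration.integrable_sum integrable_abs_dot_mult)
  let ?B = "1 + z / 2 + z\<^sup>2 / 8 + 960 * z ^ 3"
  have inner: "(\<Sum>y\<in>cube n. \<integral>\<theta>. ?g x y \<theta> \<partial>\<sigma>) \<le> 2 ^ n * (2 / pi * ?B)" if x: "x \<in> cube n" for x
  proof -
    let ?D = "dot n x"
    note M = cube_moments[of n x, OF cube_sign[OF x], simplified]
    have "(\<Sum>y\<in>cube n. \<integral>\<theta>. ?g x y \<theta> \<partial>\<sigma>)
        \<le> (\<Sum>y\<in>cube n. 2 / pi * (1 + (?D y / n)\<^sup>2 / 2 + (?D y / n) ^ 4 / 24 + 64 * (?D y / n) ^ 6))"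
      by (intro sum_mono integral_abs_dot_product_le dot_self_cube x)
    also have "\<dots> = 2 / pi * (2 ^ n + z ^ 2 / 2 * (\<Sum>y\<in>cube n. ?D y ^ 2)
        + z ^ 4 / 24 * (\<Sum>y\<in>cube n. ?D y ^ 4) + 64 * z ^ 6 * (\<Sum>y\<in>cube n. ?D y ^ 6))"
    proof -
      have "1 + (t / n)\<^sup>2 / 2 + (t / n) ^ 4 / 24 + 64 * (t / n) ^ 6
          = 1 + z ^ 2 / 2 * t ^ 2 + z ^ 4 / 24 * t ^ 4 + 64 * z ^ 6 * t ^ 6" for t
        by (simp add: z_def power_divide)
      then show ?thesis
        by (simp only: sum.distrib flip: sum_distrib_left) (simp add: card_cube)
    qed
    also have "\<dots> \<le> 2 / pi * (2 ^ n + z ^ 2 / 2 * (2 ^ n * n)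
        + z ^ 4 / 24 * (2 ^ n * (3 * real n ^ 2 - 2 * n)) + 64 * z ^ 6 * (2 ^ n * (15 * real n ^ 3)))"
      unfolding M(1,2) using z M(3) by (intro mult_left_mono add_left_mono) auto
    also have "\<dots> = 2 ^ n * (2 / pi * (1 + z / 2 + z\<^sup>2 / 8 - z ^ 3 / 12 + 960 * z ^ 3))"
      using n_pos by (simp add: z_def field_simps eval_nat_numeral)
    also have "\<dots> \<le> 2 ^ n * (2 / pi * ?B)"
      using z by (intro mult_left_mono) auto
    finally show ?thesis .
  qed
  have "(\<integral>\<theta>. (F_fun n (cube_measure n) \<theta>)\<^sup>2 \<partial>\<sigma>)
      = (\<Sum>x\<in>cube n. \<Sum>y\<in>cube n. \<integral>\<theta>. ?g x y \<theta> \<partial>\<sigma>) / (2 ^ Suc n)\<^sup>2"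
    unfolding F by (simp add: integrable_abs_dot_mult Bochner_Integration.integral_sum)
  also have "\<dots> \<le> (\<Sum>x\<in>cube n. 2 ^ n * (2 / pi * ?B)) / (2 ^ Suc n)\<^sup>2"
    by (intro divide_right_mono sum_mono inner) auto
  also have "\<dots> = 1 / (2 * pi) * ?B"
  proof -
    have "(\<Sum>x\<in>cube n. 2 ^ n * (2 / pi * t)) / (2 ^ Suc n)\<^sup>2 = 1 / (2 * pi) * t" for t :: real
      by (simp add: card_cube field_simps power2_eq_square)
    then show ?thesis .
  qed
  finally show "(\<integral>\<theta>. (F_fun n (cube_measure n) \<theta>)\<^sup>2 \<partial>\<sigma>) \<le> 1 / (2 * pi) * ?B" .
qed

lemma first_moment_F:
  "integrable \<sigma> (F_fun n (cube_measure n))"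
  "(\<integral>\<theta>. F_fun n (cube_measure n) \<theta> \<partial>\<sigma>) = sqrt n * mean_abs / 2"
proof -
  have F: "F_fun n (cube_measure n) = (\<lambda>\<theta>. (\<Sum>x\<in>cube n. \<bar>dot n x \<theta>\<bar>) / 2 ^ Suc n)"
    by (rule ext) (rule F_fun_cube)
  show "integrable \<sigma> (F_fun n (cube_measure n))"
    unfolding F by (intro integrable_divide Bochner_Integration.integrable_sum integrable_abs_dot)
  have "(\<integral>\<theta>. F_fun n (cube_measure n) \<theta> \<partial>\<sigma>) = (\<Sum>x\<in>cube n. sqrt n * mean_abs) / 2 ^ Suc n"
    unfolding F by (simp add: integrable_abs_dot Bochner_Integration.integral_sum integral_abs_dot dot_self_cube)
  then show "(\<integral>\<theta>. F_fun n (cube_measure n) \<theta> \<partial>\<sigma>) = sqrt n * mean_abs / 2"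
    by (simp add: card_cube)
qed

lemma variance_F_le: "variance (F_fun n (cube_measure n)) \<le> 10000 / real n ^ 3"
proof -
  define z where "z = 1 / real n"
  define d where "d = z / 4 - z ^ 2 / 32 - 13 * z ^ 3"
  have z: "0 \<le> z" "z \<le> 1" using n_pos by (auto simp: z_def)
  have "variance (F_fun n (cube_measure n))
      = (\<integral>\<theta>. (F_fun n (cube_measure n) \<theta>)\<^sup>2 \<partial>\<sigma>) - (\<integral>\<theta>. F_fun n (cube_measure n) \<theta> \<partial>\<sigma>)\<^sup>2"
    by (rule variance_eq[OF first_moment_F(1) second_moment_F(1)])
  also have "(\<integral>\<theta>. F_fun n (cube_measure n) \<theta> \<partial>\<sigma>)\<^sup>2 = n * mean_abs\<^sup>2 / 4"
    by (simp add: first_moment_F(2) power_divide power_mult_distrib)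
  also have "(\<integral>\<theta>. (F_fun n (cube_measure n) \<theta>)\<^sup>2 \<partial>\<sigma>) - n * mean_abs\<^sup>2 / 4
      \<le> 1 / (2 * pi) * (1 + z / 2 + z\<^sup>2 / 8 + 960 * z ^ 3) - 2 / pi * (1 + 2 * d + 3 * d\<^sup>2 + 4 * d ^ 3) / 4"
    using second_moment_F(2) mean_abs_square_lower unfolding z_def[symmetric] d_def[symmetric]
    by (intro diff_mono divide_right_mono) auto
  also have "\<dots> = 1 / (2 * pi) * (z / 2 + z\<^sup>2 / 8 + 960 * z ^ 3 - (2 * d + 3 * d\<^sup>2 + 4 * d ^ 3))"
    by (simp add: field_simps)
  also have "\<dots> \<le> 1 / (2 * pi) * (12960 * z ^ 3)"
    using deficit_expansion[OF z] unfolding d_def[symmetric] by (intro mult_left_mono) auto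
  also have "\<dots> \<le> 1 / 2 * (12960 * z ^ 3)"
    using z pi_gt3 by (intro mult_right_mono) (auto simp: field_simps)
  also have "\<dots> \<le> 10000 * z ^ 3" using z by simp
  also have "\<dots> = 10000 / real n ^ 3" by (simp add: z_def power_divide)
  finally show ?thesis .
qed

end

theorem theorem3:
  shows "\<exists>C::real. C > 0 \<and>
    (\<forall>n\<ge>1. \<forall>\<sigma>. uniform_sphere_measure n \<sigma> \<longrightarrow>
      prob_space.variance \<sigma> (F_fun n (cube_measure n)) \<le> C / real n ^ 3)"
proof (intro exI conjI allI impI)
  fix n :: nat and \<sigma> assume "1 \<le> n" "uniform_sphere_measure n \<sigma>"
  then interpret invariant_sphere n \<sigma> by unfold_locales
  show "variance (F_fun n (cube_measure n)) \<le> 10000 / real n ^ 3" by (rule variance_F_le)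
qed simp

end
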